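(* Let $m\ge 2$ be even, $d_0\ge 1$, let $R=\sum_{i=0}^{d_0} a_ix^{2^i}\in\mathbf{F}_{2^m}[x]$ with $a_{d_0}\neq 0$, and set $f(x)=xR(x)$. Let $\widetilde R=\sum_{i=0}^{d_0}\left(a_i^{2^{d_0}}x^{2^{d_0+i}}+a_i^{2^{d_0-i}}x^{2^{d_0-i}}\right)$, let $\mathbf{F}_{2^{mN}}$ be the splitting field of $\widetilde R$ over $\mathbf{F}_{2^m}$, and write $N=2^aN'$ with $N'$ odd. Let $m_\ell(f)$ be the multiplicities in the factorization $L^\ast(f,T)=\prod_\ell\Phi_\ell(T)^{m_\ell(f)}$. Then these multiplicities satisfy the following systems: (i) if $\varepsilon_N(f)=-1$: $A(N)\,(m_\ell(f))_{\ell|N}=(-S_d^\ast(f))_{d|N}$; (ii) if $\varepsilon_N(f)=1$: $2^aA(N')\,(m_{2^{a+1}\ell}(f))_{\ell|N'}=(S^\ast_{2^ad}(f))_{d|N'}$; (iiia) if $\varepsilon_N(f)=0$ and $\varepsilon_{2N}(f)=-1$: $A(2N)\,(m_\ell(f))_{\ell|2N}=(-S_d^\ast(f))_{d|2N}$; (iiib) if $\varepsilon_N(f)=0$ and $\varepsilon_{2N}(f)=1$: $2^{a+1}A(N')\,(m_{2^{a+2}\ell}(f))_{\ell|N'}=(S^\ast_{2^{a+1}d}(f))_{d|N'}$.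
   Context: For a quadratic form $q$ on a $k$-dimensional $\mathbf{F}_2$-vector space $V$, with polarisation $b(x,y)=q(x+y)+q(x)+q(y)$ whose radical has dimension $c$ (set $r=k-c$), the invariant $\varepsilon(q)\in\{0,1,-1\}$ is defined as follows: $\varepsilon(q)=0$ if $q$ is not identically zero on the radical of $b$ (equivalently $q$ is isometric to $x_1x_2+\cdots+x_{r-1}x_r+x_{r+1}^2$); $\varepsilon(q)=1$ if $q$ is isometric to $x_1x_2+\cdots+x_{r-1}x_r$; $\varepsilon(q)=-1$ if $q$ is isometric to $x_1^2+x_1x_2+x_2^2+x_3x_4+\cdots+x_{r-1}x_r$. One has $\sum_{x\in V}(-1)^{q(x)}=\varepsilon(q)2^{(k+c)/2}$. For $n\ge1$, $\varepsilon_n(f):=\varepsilon(q_n)$ where $q_n=\mathrm{Tr}_{\mathbf{F}_{2^{mn}}/\mathbf{F}_2}\circ f$, a quadratic form on the $\mathbf{F}_2$-vector space $\mathbf{F}_{2^{mn}}$. Put $S_n(f)=\sum_{x\in\mathbf{F}_{2^{mn}}}(-1)^{\mathrm{Tr}_{\mathbf{F}_{2^{mn}}/\mathbf{F}_2}(f(x))}$, $S_n^\ast(f)=(\sqrt2)^{-mn}S_n(f)$, $L(f,T)=\exp\left(\sum_{n\ge1}S_n(f)\frac{T^n}{n}\right)$, and $L^\ast(f,T)=L(f,T/\sqrt2^{\,m})$. It is known that $L^\ast(f,T)$ is a polynomial of degree $2^{d_0}$ whose reciprocal roots are roots of unity, with integer coefficients when $m$ is even; hence it factors as $\prod_{\ell\ge1}\Phi_\ell(T)^{m_\ell(f)}$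 with $m_\ell(f)\ge0$, where $\Phi_\ell(T)=\prod_{i\in(\mathbf{Z}/\ell\mathbf{Z})^\times}(1-\zeta_\ell^iT)$ and $\zeta_\ell=e^{2i\pi/\ell}$. For $\ell,n\ge1$, $c_\ell(n)=\sum_{i\in(\mathbf{Z}/\ell\mathbf{Z})^\times}\zeta_\ell^{ni}$ is the Ramanujan sum, and for $n\ge1$, $A(n)=(c_\ell(d))_{d,\ell|n}$ is the square matrix with rows indexed by the divisors $d$ of $n$ and columns indexed by the divisors $\ell$ of $n$. Vectors indexed by divisors are column vectors. *)

theory Defs
  imports
    Complex_Main
    "HOL-Library.Z2"
    "HOL-Algebra.Algebraic_Closure_Type"
    "HOL-Algebra.Generated_Fields"
    "HOL-Computational_Algebra.Formal_Power_Series"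
    "HOL-Computational_Algebra.Polynomial_FPS"
    "HOL-Number_Theory.Totient"
begin

section \<open>Finite fields of characteristic 2\<close>

text \<open>All finite fields live in the algebraic closure of the two-element field \<^typ>\<open>bit\<close>.\<close>

type_synonym F2bar = "bit alg_closure"

text \<open>The subfield with \<open>2 ^ k\<close> elements; only meaningful for \<open>k \<ge> 1\<close>, as \<open>GF2 0 = UNIV\<close>.\<close>

definition GF2 :: "nat \<Rightarrow> F2bar set" where
  "GF2 k = {x. x ^ (2 ^ k) = x}"

definition F2_scale :: "bit \<Rightarrow> F2bar \<Rightarrow> F2bar" where
  "F2_scale c x = to_ac c * x"

lemma vector_space_F2_scale: "vector_space F2_scale"
  by unfold_locales
    (simp_all only: F2_scale_def to_ac_add to_ac_mult to_ac_1 distrib_left distrib_right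
      mult.assoc mult_1_left)

text \<open>The trace from \<open>GF2 k\<close> to the prime field, as the sum of the Galois conjugates.\<close>

definition trace_F2 :: "nat \<Rightarrow> F2bar \<Rightarrow> bit" where
  "trace_F2 k x = of_ac (\<Sum>i<k. x ^ (2 ^ i))"

text \<open>The splitting field of \<open>p\<close> over the subfield \<open>F\<close>: adjoin all roots of \<open>p\<close> to \<open>F\<close>.\<close>

definition splitting_field :: "F2bar set \<Rightarrow> F2bar poly \<Rightarrow> F2bar set" where
  "splitting_field F p = generate_field ring_of_type_algebra (F \<union> {x. poly p x = 0})"


section \<open>Quadratic forms over the two-element field\<close>

text \<open>
  A quadratic form is a function \<open>q\<close> on a subspace \<open>V\<close> of an ambient vector space over
  \<^typ>\<open>bit\<close> with scalar multiplication \<open>scale\<close>; its values outside \<open>V\<close> play no role.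
\<close>

definition polar :: "('v::ab_group_add \<Rightarrow> bit) \<Rightarrow> 'v \<Rightarrow> 'v \<Rightarrow> bit" where
  "polar q x y = q (x + y) + q x + q y"

definition radical :: "'v::ab_group_add set \<Rightarrow> ('v \<Rightarrow> bit) \<Rightarrow> 'v set" where
  "radical V q = {x \<in> V. \<forall>y\<in>V. polar q x y = 0}"

text \<open>The coordinate space of dimension \<open>k\<close>, with coordinates indexed by \<open>1, \<dots>, k\<close>.\<close>

definition coord_space :: "nat \<Rightarrow> (nat \<Rightarrow> bit) set" where
  "coord_space k = {u. \<forall>i. i \<notin> {1..k} \<longrightarrow> u i = 0}"

definition isometric_to ::
  "(bit \<Rightarrow> 'v::ab_group_add \<Rightarrow> 'v) \<Rightarrow> 'v set \<Rightarrow> ('v \<Rightarrow> bit) \<Rightarrow> ((nat \<Rightarrow> bit) \<Rightarrow> bit) \<Rightarrow> bool"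
where
  "isometric_to scale V q Q \<longleftrightarrow>
     (\<exists>\<phi>. bij_betw \<phi> V (coord_space (vector_space.dim scale V)) \<and>
          (\<forall>x\<in>V. \<forall>y\<in>V. \<phi> (x + y) = (\<lambda>i. \<phi> x i + \<phi> y i)) \<and>
          (\<forall>c. \<forall>x\<in>V. \<phi> (scale c x) = (\<lambda>i. c * \<phi> x i)) \<and>
          (\<forall>x\<in>V. q x = Q (\<phi> x)))"

text \<open>
  \<open>x\<^sub>1 x\<^sub>2 + \<dots> + x\<^bsub>r-1\<^esub> x\<^sub>r\<close> and
  \<open>x\<^sub>1\<^sup>2 + x\<^sub>1 x\<^sub>2 + x\<^sub>2\<^sup>2 + x\<^sub>3 x\<^sub>4 + \<dots> + x\<^bsub>r-1\<^esub> x\<^sub>r\<close>.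
\<close>

definition hyperbolic_form :: "nat \<Rightarrow> (nat \<Rightarrow> bit) \<Rightarrow> bit" where
  "hyperbolic_form r x = (\<Sum>j\<in>{1..r div 2}. x (2 * j - 1) * x (2 * j))"

definition elliptic_form :: "nat \<Rightarrow> (nat \<Rightarrow> bit) \<Rightarrow> bit" where
  "elliptic_form r x = (x 1)\<^sup>2 + x 1 * x 2 + (x 2)\<^sup>2 + (\<Sum>j\<in>{2..r div 2}. x (2 * j - 1) * x (2 * j))"

text \<open>
  The rank \<open>r\<close> is always even. The elliptic normal form only exists for \<open>r \<ge> 2\<close>. By the
  classification of quadratic forms over the two-element field the last branch is never taken on
  a quadratic form; its value is junk outside \<open>{0, 1, -1}\<close>.
\<close>

definition quad_eps :: "(bit \<Rightarrow> 'v::ab_group_add \<Rightarrow> 'v) \<Rightarrow> 'v set \<Rightarrow> ('v \<Rightarrow> bit) \<Rightarrow> int" where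
  "quad_eps scale V q =
     (let r = vector_space.dim scale V - vector_space.dim scale (radical V q) in
      if \<exists>x\<in>radical V q. q x \<noteq> 0 then 0
      else if isometric_to scale V q (hyperbolic_form r) then 1
      else if r \<ge> 2 \<and> isometric_to scale V q (elliptic_form r) then -1
      else 2)"


section \<open>Exponential sums and the L-function\<close>

text \<open>
  Throughout, \<open>f\<close> is a polynomial with coefficients in \<open>GF2 m\<close>, and the sums are over the extension
  \<open>GF2 (m * n)\<close> of degree \<open>n\<close>.
\<close>

definition eps_n :: "nat \<Rightarrow> F2bar poly \<Rightarrow> nat \<Rightarrow> int" where
  "eps_n m f n = quad_eps F2_scale (GF2 (m * n)) (\<lambda>x. trace_F2 (m * n) (poly f x))"

definition exp_sum :: "nat \<Rightarrow> F2bar poly \<Rightarrow> nat \<Rightarrow> int" where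
  "exp_sum m f n = (\<Sum>x\<in>GF2 (m * n). if trace_F2 (m * n) (poly f x) = 0 then 1 else -1)"

definition exp_sum_star :: "nat \<Rightarrow> F2bar poly \<Rightarrow> nat \<Rightarrow> complex" where
  "exp_sum_star m f n = of_int (exp_sum m f n) / of_real (sqrt 2) ^ (m * n)"

definition L_fun :: "nat \<Rightarrow> F2bar poly \<Rightarrow> complex fps" where
  "L_fun m f =
     fps_exp 1 oo Abs_fps (\<lambda>n. if n = 0 then 0 else of_int (exp_sum m f n) / of_nat n)"

definition L_star :: "nat \<Rightarrow> F2bar poly \<Rightarrow> complex fps" where
  "L_star m f = L_fun m f oo (fps_const (1 / of_real (sqrt 2) ^ m) * fps_X)"


section \<open>Cyclotomic factorization and Ramanujan sums\<close>

definition zeta :: "nat \<Rightarrow> complex" where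
  "zeta l = cis (2 * pi / real l)"

text \<open>Normalized to have constant term 1: for \<open>l = 1\<close> this is \<open>1 - T\<close>.\<close>

definition cyclotomic :: "nat \<Rightarrow> complex poly" where
  "cyclotomic l = (\<Prod>i\<in>totatives l. [:1, - (zeta l ^ i):])"

text \<open>
  \<open>\<mu>\<close> is the family of multiplicities of the cyclotomic factorization of the power series \<open>P\<close>.
  The product over all \<open>l \<ge> 1\<close> is a finite product over the support of \<open>\<mu>\<close>; \<open>\<mu> 0\<close> is irrelevant.
\<close>

definition cyclotomic_multiplicities :: "complex fps \<Rightarrow> (nat \<Rightarrow> nat) \<Rightarrow> bool" where
  "cyclotomic_multiplicities P \<mu> \<longleftrightarrow>
     finite {l. l \<ge> 1 \<and> \<mu> l \<noteq> 0} \<and>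
     P = fps_of_poly (\<Prod>l\<in>{l. l \<ge> 1 \<and> \<mu> l \<noteq> 0}. cyclotomic l ^ \<mu> l)"

definition ramanujan_sum :: "nat \<Rightarrow> nat \<Rightarrow> complex" where
  "ramanujan_sum l n = (\<Sum>i\<in>totatives l. zeta l ^ (n * i))"

text \<open>
  Square matrices and column vectors indexed by the divisors of \<open>n\<close> are functions on
  divisors, extended by \<open>undefined\<close>.
\<close>

definition divisor_vec :: "nat \<Rightarrow> (nat \<Rightarrow> complex) \<Rightarrow> (nat \<Rightarrow> complex)" where
  "divisor_vec n v = (\<lambda>d\<in>{d. d dvd n}. v d)"

definition ramanujan_matrix :: "nat \<Rightarrow> nat \<Rightarrow> nat \<Rightarrow> complex" where
  "ramanujan_matrix n = (\<lambda>d\<in>{d. d dvd n}. \<lambda>l\<in>{l. l dvd n}. ramanujan_sum l d)"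

definition divisor_mat_vec ::
  "nat \<Rightarrow> (nat \<Rightarrow> nat \<Rightarrow> complex) \<Rightarrow> (nat \<Rightarrow> complex) \<Rightarrow> (nat \<Rightarrow> complex)" where
  "divisor_mat_vec n A v = (\<lambda>d\<in>{d. d dvd n}. \<Sum>l | l dvd n. A d l * v l)"

definition divisor_mat_scale ::
  "nat \<Rightarrow> complex \<Rightarrow> (nat \<Rightarrow> nat \<Rightarrow> complex) \<Rightarrow> (nat \<Rightarrow> nat \<Rightarrow> complex)" where
  "divisor_mat_scale n c A = (\<lambda>d\<in>{d. d dvd n}. \<lambda>l\<in>{l. l dvd n}. c * A d l)"

end

theory Submission
  imports Defs
begin

text \<open>
  Taking logarithmic derivatives in the cyclotomic factorisation of the L-function gives
  \<open>S\<^sup>*\<^sub>n = - \<Sum>\<^sub>l \<mu>\<^sub>l c\<^sub>l(n)\<close> for all \<open>n \<ge> 1\<close> (\<open>exp_sum_star_eq_ramanujan\<close>): the normalised sum is minus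
  the sum of the \<open>n\<close>-th powers of the reciprocal roots, of which there are \<open>D = \<Sum>\<^sub>l \<mu>\<^sub>l \<phi>(l)\<close>. So
  everything depends on finding out which orders \<open>l\<close> can occur.

  The polarisation of \<open>x \<mapsto> Tr (x R(x))\<close> is \<open>(x, y) \<mapsto> Tr (y\<^bsup>2^d\<^esup> R'(x))\<close>, where \<open>d\<close> is \<open>d\<^sub>0\<close> and \<open>R'\<close> is
  the separable polynomial called \<open>Rt\<close> in the theorem, of degree \<open>2\<^bsup>2d\<^esup>\<close> (\<open>polar_trace\<close>,
  \<open>card_roots_radical_poly\<close>). Once a field contains all its roots, they form the radical. The square of
  the exponential sum of a quadratic form on \<open>V\<close> is the cardinality of \<open>V\<close> times the sum over the radical
  (\<open>square_eq_radical_sum\<close>). Hence over such a field \<open>\<bar>S\<^sup>*\<^sub>n\<bar> \<le> 2\<^sup>d\<close>, and if \<open>\<epsilon>\<^sub>n = \<plusminus>1\<close> then \<open>S\<^sup>*\<^sub>n = \<epsilon>\<^sub>n 2\<^sup>d\<close>,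
  the sign being read off from the normal form.

  Let \<open>M\<close> be \<open>N\<close> or \<open>2 N\<close>, with \<open>\<epsilon>\<^sub>M = \<plusminus>1\<close>. The bound at a common multiple of \<open>M\<close> and of all orders, where
  every root contributes 1, shows \<open>D \<le> 2\<^sup>d\<close>; and the \<open>M\<close>-th powers of these \<open>D\<close> numbers add up to
  \<open>- \<epsilon>\<^sub>M 2\<^sup>d\<close>. Equality in the triangle inequality forces each \<open>M\<close>-th power to be \<open>- \<epsilon>\<^sub>M\<close>
  (\<open>zeta_power_eq_minus_eps\<close>).

  For \<open>\<epsilon>\<^sub>M = -1\<close> all orders therefore divide \<open>M\<close>, and the system is the formula for \<open>S\<^sup>*\<^sub>n\<close> read at the
  divisors of \<open>M\<close>. For \<open>\<epsilon>\<^sub>M = 1\<close> and \<open>M = 2\<^sup>b N'\<close> with \<open>N'\<close> odd, all orders have the form \<open>2\<^bsup>b+1\<^esup> l\<close> with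
  \<open>l\<close> dividing \<open>N'\<close>, and the system follows from \<open>c\<^sub>k(2\<^sup>b e) = - 2\<^sup>b c\<^sub>l(e)\<close> for \<open>k = 2\<^bsup>b+1\<^esup> l\<close> and odd \<open>l\<close>, \<open>e\<close>
  (\<open>ramanujan_sum_two_power\<close>).
\<close>

section \<open>Exponential sums of quadratic forms\<close>

definition bit_sign :: "bit \<Rightarrow> int" where
  "bit_sign b = (if b = 0 then 1 else -1)"

lemma bit_sign_0 [simp]: "bit_sign 0 = 1"
  by (simp add: bit_sign_def)

lemma bit_sign_1 [simp]: "bit_sign 1 = -1"
  by (simp add: bit_sign_def)

lemma bit_sign_add: "bit_sign (a + b) = bit_sign a * bit_sign b"
  by (cases a; cases b) (simp_all add: bit_sign_def)

lemma bit_sign_square [simp]: "bit_sign b * bit_sign b = 1"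
  by (simp add: bit_sign_def)

lemma bit_sign_of_bool [simp]:
  "bit_sign (of_bool (b = 1)) = bit_sign b"
  "bit_sign (of_bool (b = 0)) = - bit_sign b"
  by (cases b; simp)+

lemma bit_add_self [simp]: "(b::bit) + b = 0"
  by (cases b) simp_all

lemma polar_commute: "polar q x y = polar q y x"
  by (simp only: polar_def ac_simps)

text \<open>
  Over the two-element field, additivity of the polarisation in one variable makes \<open>q\<close> a quadratic
  form: the only scalars are 0 and 1, symmetry gives additivity in the other variable, and \<open>q 0 = 0\<close> follows by polarising at 0.
\<close>

locale finite_quadratic =
  fixes V :: "'v::ab_group_add set" and q :: "'v \<Rightarrow> bit"
  assumes finite_V: "finite V"
    and zero_mem: "0 \<in> V"
    and add_mem: "\<And>x y. x \<in> V \<Longrightarrow> y \<in> V \<Longrightarrow> x + y \<in> V"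
    and diff_mem: "\<And>x y. x \<in> V \<Longrightarrow> y \<in> V \<Longrightarrow> x - y \<in> V"
    and polar_add: "\<And>x y z. x \<in> V \<Longrightarrow> y \<in> V \<Longrightarrow> z \<in> V \<Longrightarrow>
          polar q (x + y) z = polar q x z + polar q y z"
begin

lemma sum_translate:
  assumes "z \<in> V"
  shows "(\<Sum>x\<in>V. g (x + z)) = (\<Sum>x\<in>V. g x)"
  by (rule sum.reindex_bij_witness[of _ "\<lambda>x. x - z" "\<lambda>x. x + z"])
     (use assms add_mem diff_mem in auto)

text \<open>
  Orthogonality: translating by some \<open>z\<close> with \<open>h z = 1\<close> changes the sign of the whole sum.
\<close>

lemma character_sum:
  assumes h: "\<And>x y. x \<in> V \<Longrightarrow> y \<in> V \<Longrightarrow> h (x + y) = h x + h y"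
  shows "(\<Sum>x\<in>V. bit_sign (h x)) = (if \<forall>x\<in>V. h x = 0 then int (card V) else 0)"
proof (cases "\<forall>x\<in>V. h x = 0")
  case False
  then obtain z where z: "z \<in> V" "h z = 1"
    by auto
  have "(\<Sum>x\<in>V. bit_sign (h x)) = (\<Sum>x\<in>V. bit_sign (h (x + z)))"
    using sum_translate[OF z(1), of "\<lambda>x. bit_sign (h x)"] by simp
  also have "\<dots> = (\<Sum>x\<in>V. - bit_sign (h x))"
    by (rule sum.cong) (use z h in \<open>auto simp: bit_sign_add\<close>)
  finally have "(\<Sum>x\<in>V. bit_sign (h x)) = 0"
    by (simp add: sum_negf)
  then show ?thesis
    by (simp only: if_not_P[OF False])
qed simp

lemma quad_add: "q (x + y) = polar q x y + q x + q y"
  by (cases "q (x + y)"; cases "q x"; cases "q y"; simp add: polar_def)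

text \<open>
  In the double sum over \<open>x\<close> and \<open>y\<close> put \<open>x = u + y\<close>. As \<open>q (u + y) + q y = q u + b(u, y)\<close>, the
  sum over \<open>y\<close> is a character sum, which survives only for \<open>u\<close> in the radical.
\<close>

lemma square_eq_radical_sum:
  "(\<Sum>x\<in>V. bit_sign (q x))\<^sup>2 = int (card V) * (\<Sum>u\<in>radical V q. bit_sign (q u))"
proof -
  have "(\<Sum>x\<in>V. bit_sign (q x))\<^sup>2 = (\<Sum>y\<in>V. (\<Sum>x\<in>V. bit_sign (q x)) * bit_sign (q y))"
    by (simp add: power2_eq_square sum_distrib_left)
  also have "\<dots> = (\<Sum>y\<in>V. \<Sum>u\<in>V. bit_sign (q (u + y)) * bit_sign (q y))"
    by (rule sum.cong[OF refl], subst sum_translate[symmetric], assumption) (simp add: sum_distrib_right)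
  also have "\<dots> = (\<Sum>u\<in>V. \<Sum>y\<in>V. bit_sign (q u) * bit_sign (polar q y u))"
  proof (subst sum.swap, intro sum.cong refl)
    fix u y
    show "bit_sign (q (u + y)) * bit_sign (q y) = bit_sign (q u) * bit_sign (polar q y u)"
      unfolding quad_add[of u y] bit_sign_add polar_commute[of q u y] by (simp add: mult.assoc)
  qed
  also have "\<dots> = (\<Sum>u\<in>V. bit_sign (q u) * (\<Sum>y\<in>V. bit_sign (polar q y u)))"
    by (simp add: sum_distrib_left)
  also have "\<dots> = (\<Sum>u\<in>V. if u \<in> radical V q then bit_sign (q u) * int (card V) else 0)"
  proof (rule sum.cong[OF refl])
    fix u assume u: "u \<in> V"
    show "bit_sign (q u) * (\<Sum>y\<in>V. bit_sign (polar q y u)) =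
        (if u \<in> radical V q then bit_sign (q u) * int (card V) else 0)"
      by (subst character_sum) (use u polar_add in \<open>auto simp: radical_def polar_commute[of q u]\<close>)
  qed
  also have "\<dots> = (\<Sum>u\<in>radical V q. bit_sign (q u) * int (card V))"
    by (rule sum.mono_neutral_cong_right) (use finite_V in \<open>auto simp: radical_def\<close>)
  finally show ?thesis
    by (simp add: sum_distrib_left mult.commute)
qed

lemma square_le: "(\<Sum>x\<in>V. bit_sign (q x))\<^sup>2 \<le> int (card V * card (radical V q))"
proof -
  have "(\<Sum>u\<in>radical V q. bit_sign (q u)) \<le> (\<Sum>u\<in>radical V q. 1)"
    by (rule sum_mono) (simp add: bit_sign_def)
  then show ?thesis
    by (simp add: square_eq_radical_sum mult_left_mono)
qed

lemma square_eq:
  assumes "\<forall>u\<in>radical V q. q u = 0"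
  shows "(\<Sum>x\<in>V. bit_sign (q x))\<^sup>2 = int (card V * card (radical V q))"
  using assms by (simp add: square_eq_radical_sum)

end


section \<open>Normal forms\<close>


lemma coord_space_0: "coord_space 0 = {\<lambda>_. 0}"
  by (auto simp: coord_space_def)

lemma UNIV_bit: "(UNIV :: bit set) = {0, 1}"
  by (auto elim: bit.exhaust)

lemma sum_coord_space_Suc:
  fixes g :: "(nat \<Rightarrow> bit) \<Rightarrow> int"
  shows "(\<Sum>u\<in>coord_space (Suc k). g u) =
     (\<Sum>u\<in>coord_space k. g (u(Suc k := 0)) + g (u(Suc k := 1)))"
proof -
  have "(\<Sum>u\<in>coord_space (Suc k). g u) =
      (\<Sum>(u, b)\<in>coord_space k \<times> UNIV. g (u(Suc k := b)))"
    by (rule sum.reindex_bij_witness[of _ "\<lambda>(u, b). u(Suc k := b)" "\<lambda>u. (u(Suc k := 0), u (Suc k))"])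
       (auto simp: coord_space_def fun_eq_iff)
  then show ?thesis
    by (simp add: sum.cartesian_product[symmetric] UNIV_bit)
qed

text \<open>
  Each hyperbolic plane \<open>u\<^bsub>2i-1\<^esub> u\<^bsub>2i\<^esub>\<close> multiplies the exponential sum by
  \<open>1 + 1 + 1 - 1 = 2\<close>. The first \<open>2 s\<close> coordinates are left to an arbitrary form \<open>g\<close>: it is \<open>0\<close> for
  the hyperbolic normal form, and the anisotropic plane for the elliptic one.
\<close>

lemma sum_planes:
  fixes g :: "(nat \<Rightarrow> bit) \<Rightarrow> bit"
  assumes g: "\<And>u i b. i > 2 * s \<Longrightarrow> g (u(i := b)) = g u" and "s \<le> j"
  shows "(\<Sum>u\<in>coord_space (2 * j). bit_sign (g u + (\<Sum>i\<in>{s<..j}. u (2 * i - 1) * u (2 * i)))) =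
      2 ^ (j - s) * (\<Sum>u\<in>coord_space (2 * s). bit_sign (g u))"
  using \<open>s \<le> j\<close>
proof (induction j rule: dec_induct)
  case (step j)
  define h where "h = (\<lambda>u::nat \<Rightarrow> bit. g u + (\<Sum>i\<in>{s<..j}. u (2 * i - 1) * u (2 * i)))"
  have h: "h (u(i := b)) = h u" if "i > 2 * j" for u i b
    unfolding h_def using that step.hyps
    by (intro arg_cong2[of _ _ _ _ "(+)"] g sum.cong) auto
  have *: "g u + (\<Sum>i\<in>{s<..Suc j}. u (2 * i - 1) * u (2 * i)) = h u + u (Suc (2 * j)) * u (Suc (Suc (2 * j)))" for u
  proof -
    have split: "(\<Sum>i\<in>{s<..Suc j}. F i) = F (Suc j) + (\<Sum>i\<in>{s<..j}. F i)" for F :: "nat \<Rightarrow> bit"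
    proof -
      have "{s<..Suc j} = insert (Suc j) {s<..j}"
        using step.hyps by auto
      then show ?thesis
        by simp
    qed
    have index: "2 * Suc j - 1 = Suc (2 * j)" "2 * Suc j = Suc (Suc (2 * j))"
      by simp_all
    show ?thesis
      unfolding h_def split index by (simp only: diff_Suc_1 ac_simps)
  qed
   have "(\<Sum>u\<in>coord_space (2 * Suc j). bit_sign (h u + u (Suc (2 * j)) * u (Suc (Suc (2 * j))))) =
     (\<Sum>u\<in>coord_space (2 * j). 2 * bit_sign (h u))"
    by (simp add: sum_coord_space_Suc h bit_sign_add)
  then show ?case
    unfolding * using step by (simp add: h_def sum_distrib_left[symmetric] Suc_diff_le)
qed simp

lemma sum_ignored_coordinates:
  fixes h :: "(nat \<Rightarrow> bit) \<Rightarrow> bit"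
  assumes h: "\<And>u i b. i > r \<Longrightarrow> h (u(i := b)) = h u" and "r \<le> k"
  shows "(\<Sum>u\<in>coord_space k. bit_sign (h u)) = 2 ^ (k - r) * (\<Sum>u\<in>coord_space r. bit_sign (h u))"
  using \<open>r \<le> k\<close>
  by (induction k rule: dec_induct)
     (simp_all add: sum_coord_space_Suc h Suc_diff_le sum_distrib_left[symmetric])

text \<open>
  Only the signs of the two normal forms matter below, since the absolute value of the sum follows from
  the cardinality of the radical.
\<close>

lemma hyperbolic_sum_pos:
  assumes "r \<le> k"
  shows "(\<Sum>u\<in>coord_space k. bit_sign (hyperbolic_form r u)) > 0"
proof -
  have "(\<Sum>u\<in>coord_space k. bit_sign (hyperbolic_form r u)) =
      2 ^ (k - 2 * (r div 2)) * (\<Sum>u\<in>coord_space (2 * (r div 2)). bit_sign (hyperbolic_form r u))"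
    by (rule sum_ignored_coordinates)
       (use assms in \<open>auto simp only: hyperbolic_form_def intro!: sum.cong, auto\<close>)
  moreover have "(\<Sum>u\<in>coord_space (2 * (r div 2)). bit_sign (hyperbolic_form r u)) = 2 ^ (r div 2)"
  proof -
    have "{1..r div 2} = {0<..r div 2}"
      by auto
    then show ?thesis
      using sum_planes[of 0 "\<lambda>_. 0" "r div 2"]
      unfolding hyperbolic_form_def by (simp only: coord_space_0 mult_0_right add_0 diff_zero) simp
  qed
  ultimately show ?thesis
    by simp
qed

lemma elliptic_sum_neg:
  assumes "2 \<le> r" "r \<le> k"
  shows "(\<Sum>u\<in>coord_space k. bit_sign (elliptic_form r u)) < 0"
proof -
  have "(\<Sum>u\<in>coord_space k. bit_sign (elliptic_form r u)) =
      2 ^ (k - 2 * (r div 2)) * (\<Sum>u\<in>coord_space (2 * (r div 2)). bit_sign (elliptic_form r u))"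
    by (rule sum_ignored_coordinates)
       (use assms in \<open>auto simp only: elliptic_form_def intro!: arg_cong2[of _ _ _ _ "(+)"] sum.cong, auto\<close>)
  moreover have "{2..r div 2} = {1<..r div 2}"
    by auto
  \<comment> \<open>The anisotropic plane takes the value 0 once and the value 1 three times: \<open>1 - 3 = -2\<close>.\<close>
  moreover have "(\<Sum>u\<in>coord_space 2. bit_sign ((u 1)\<^sup>2 + u 1 * u 2 + (u 2)\<^sup>2)) = -2"
    by (simp add: eval_nat_numeral sum_coord_space_Suc coord_space_0)
  ultimately show ?thesis
    using sum_planes[of 1 "\<lambda>u. (u 1)\<^sup>2 + u 1 * u 2 + (u 2)\<^sup>2" "r div 2"] assms
    by (simp add: elliptic_form_def mult_less_0_iff)
qed

lemma isometric_sum_eq: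
  assumes "isometric_to scale V q Q"
  shows "(\<Sum>x\<in>V. bit_sign (q x)) = (\<Sum>u\<in>coord_space (vector_space.dim scale V). bit_sign (Q u))"
proof -
  obtain \<phi> where "bij_betw \<phi> V (coord_space (vector_space.dim scale V))" "\<forall>x\<in>V. q x = Q (\<phi> x)"
    using assms unfolding isometric_to_def by blast
  then show ?thesis
    by (auto simp flip: sum.reindex_bij_betw)
qed

lemma quad_eps_eq_1_imp:
  assumes "quad_eps scale V q = 1"
  shows "\<forall>x\<in>radical V q. q x = 0" "(\<Sum>x\<in>V. bit_sign (q x)) > 0"
proof -
  define r where "r = vector_space.dim scale V - vector_space.dim scale (radical V q)"
  have *: "\<not> (\<exists>x\<in>radical V q. q x \<noteq> 0)" "isometric_to scale V q (hyperbolic_form r)"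
    using assms unfolding quad_eps_def Let_def r_def[symmetric] by (simp_all only: split: if_splits) simp_all
  show "\<forall>x\<in>radical V q. q x = 0"
    using *(1) by blast
  show "(\<Sum>x\<in>V. bit_sign (q x)) > 0"
    unfolding isometric_sum_eq[OF *(2)] by (rule hyperbolic_sum_pos) (simp add: r_def)
qed

lemma quad_eps_eq_minus_1_imp:
  assumes "quad_eps scale V q = -1"
  shows "\<forall>x\<in>radical V q. q x = 0" "(\<Sum>x\<in>V. bit_sign (q x)) < 0"
proof -
  define r where "r = vector_space.dim scale V - vector_space.dim scale (radical V q)"
  have *: "\<not> (\<exists>x\<in>radical V q. q x \<noteq> 0)" "isometric_to scale V q (elliptic_form r)" "r \<ge> 2"
    using assms unfolding quad_eps_def Let_def r_def[symmetric] by (simp_all only: split: if_splits) simp_all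
  show "\<forall>x\<in>radical V q. q x = 0"
    using *(1) by blast
  show "(\<Sum>x\<in>V. bit_sign (q x)) < 0"
    unfolding isometric_sum_eq[OF *(2)] by (rule elliptic_sum_neg) (use *(3) in \<open>simp_all add: r_def\<close>)
qed

section \<open>Separable polynomials\<close>

text \<open>
  In a factorisation into linear factors, a factor occurring twice would give a common root of \<open>p\<close>
  and its derivative.
\<close>

lemma card_roots_eq_degree:
  fixes p :: "'a::alg_closed_field poly"
  assumes "p \<noteq> 0" and simple: "\<And>x. poly p x = 0 \<Longrightarrow> poly (pderiv p) x \<noteq> 0"
  shows "card {x. poly p x = 0} = degree p"
proof -
  obtain A where A: "size A = degree p" "p = smult (lead_coeff p) (\<Prod>x\<in>#A. [:-x, 1:])"
    using alg_closed_imp_factorization[OF assms(1)] by blast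
  have "count A a \<le> 1" for a
  proof (rule ccontr)
    assume "\<not> count A a \<le> 1"
    then have "replicate_mset 2 a \<subseteq># A"
      by (simp add: count_le_replicate_mset_subset_eq[symmetric])
    then obtain B where "A = replicate_mset 2 a + B"
      using mset_subset_eq_exists_conv by blast
    then have "p = smult (lead_coeff p) ([:-a, 1:] * [:-a, 1:] * (\<Prod>x\<in>#B. [:-x, 1:]))"
      using A(2) by (simp add: eval_nat_numeral mult.assoc del: mult_pCons_left mult_pCons_right)
    then obtain r where "p = [:-a, 1:] * ([:-a, 1:] * r)"
      by (metis mult.assoc mult_smult_right)
    then have "poly p a = 0" "poly (pderiv p) a = 0"
      by (simp_all add: pderiv_mult pderiv_pCons del: mult_pCons_left mult_pCons_right)
    with simple show False
      by blast
  qed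
  then have "size A = (\<Sum>x\<in>set_mset A. 1)"
    unfolding size_multiset_overloaded_eq
    by (intro sum.cong) (simp_all add: le_antisym Suc_le_eq)
  moreover have "{x. poly p x = 0} = set_mset A"
    using assms(1) by (subst A(2)) (auto simp: poly_prod_mset prod_mset_zero_iff)
  ultimately show ?thesis
    using A(1) by simp
qed


section \<open>Finite fields of characteristic two and their traces\<close>

lemma two_eq_0: "(2::F2bar) = 0"
  using to_ac_numeral[where ?'a = bit and n = "num.Bit0 num.One"] by simp

lemma add_self [simp]: "(x::F2bar) + x = 0"
  by (metis mult_2 two_eq_0 mult_zero_left)

lemma uminus_eq [simp]: "- (x::F2bar) = x"
  by (rule minus_unique) simp

lemma of_nat_even_eq_0: "even n \<Longrightarrow> of_nat n = (0::F2bar)"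
  by (auto elim!: evenE simp: two_eq_0)

lemma frobenius_add: "(x + y :: F2bar) ^ (2 ^ j) = x ^ (2 ^ j) + y ^ (2 ^ j)"
proof (induction j)
  case (Suc j)
  have "(x + y) ^ (2 ^ Suc j) = ((x + y) ^ (2 ^ j))\<^sup>2"
    by (simp add: power_mult[symmetric] mult.commute)
  also have "\<dots> = (x ^ (2 ^ j))\<^sup>2 + (y ^ (2 ^ j))\<^sup>2"
    by (simp add: Suc.IH power2_sum two_eq_0)
  finally show ?case
    by (simp add: power_mult[symmetric] mult.commute)
qed simp

lemma frobenius_sum: "(\<Sum>i\<in>A. g i :: F2bar) ^ (2 ^ j) = (\<Sum>i\<in>A. g i ^ (2 ^ j))"
  by (induction A rule: infinite_finite_induct) (simp_all add: frobenius_add power_0_left)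

lemma GF2_0 [simp]: "0 \<in> GF2 k" and GF2_1 [simp]: "1 \<in> GF2 k"
  by (simp_all add: GF2_def power_0_left)

lemma GF2_add [simp]: "x \<in> GF2 k \<Longrightarrow> y \<in> GF2 k \<Longrightarrow> x + y \<in> GF2 k"
  by (simp add: GF2_def frobenius_add)

lemma GF2_mult [simp]: "x \<in> GF2 k \<Longrightarrow> y \<in> GF2 k \<Longrightarrow> x * y \<in> GF2 k"
  by (simp add: GF2_def power_mult_distrib)

lemma GF2_divide [simp]: "x \<in> GF2 k \<Longrightarrow> y \<in> GF2 k \<Longrightarrow> x / y \<in> GF2 k"
  by (simp add: GF2_def power_divide)

lemma GF2_power [simp]: "x \<in> GF2 k \<Longrightarrow> x ^ n \<in> GF2 k"
  by (induction n) simp_all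

lemma GF2_sum: "(\<And>i. i \<in> A \<Longrightarrow> g i \<in> GF2 k) \<Longrightarrow> (\<Sum>i\<in>A. g i) \<in> GF2 k"
  by (induction A rule: infinite_finite_induct) simp_all

lemma GF2_mono:
  assumes "m dvd k" shows "GF2 m \<subseteq> GF2 k"
proof
  fix x assume x: "x \<in> GF2 m"
  obtain j where j: "k = m * j"
    using assms by blast
  have "x ^ (2 ^ (m * i)) = x" for i
    by (induction i) (use x in \<open>simp_all add: GF2_def power_add power_mult\<close>)
  then show "x \<in> GF2 k"
    by (simp add: GF2_def j)
qed

lemma card_GF2:
  assumes "k \<ge> 1" shows "card (GF2 k) = 2 ^ k"
proof -
  define p :: "F2bar poly" where "p = monom 1 (2 ^ k) + monom 1 1"
  have lt: "(1::nat) < 2 ^ k"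
    using assms one_less_power[of "2::nat" k] by simp
  have "degree p = degree (monom (1::F2bar) (2 ^ k))"
    unfolding p_def by (rule degree_add_eq_left) (use lt in \<open>simp add: degree_monom_eq\<close>)
  then have deg: "degree p = 2 ^ k"
    by (simp add: degree_monom_eq)
  have "pderiv p = 1"
    using assms by (simp add: p_def pderiv_add pderiv_monom of_nat_even_eq_0 two_eq_0 monom_0 one_pCons)
  then have "card {x. poly p x = 0} = degree p"
    by (intro card_roots_eq_degree) (use deg in auto)
  moreover have "{x. poly p x = 0} = GF2 k"
    by (auto simp: p_def GF2_def poly_monom add_eq_0_iff)
  ultimately show ?thesis
    using deg by simp
qed

lemma finite_GF2: "k \<ge> 1 \<Longrightarrow> finite (GF2 k)"
  by (rule card_ge_0_finite) (simp add: card_GF2)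

text \<open>
  Frobenius is additive with trivial kernel, so it permutes the finite set \<open>GF2 k\<close>.
\<close>

lemma GF2_frobenius_onto:
  assumes "k \<ge> 1" "z \<in> GF2 k"
  obtains y where "y \<in> GF2 k" "y ^ (2 ^ j) = z"
proof -
  have "inj_on (\<lambda>y. y ^ (2 ^ j)) (GF2 k)"
  proof (rule inj_onI)
    fix x y :: F2bar
    assume "x ^ (2 ^ j) = y ^ (2 ^ j)"
    then have "(x + y) ^ (2 ^ j) = 0"
      by (simp add: frobenius_add)
    then show "x = y"
      by (simp add: add_eq_0_iff)
  qed
  then have "(\<lambda>y. y ^ (2 ^ j)) ` GF2 k = GF2 k"
    by (intro endo_inj_surj finite_GF2 assms) auto
  then have "z \<in> (\<lambda>y. y ^ (2 ^ j)) ` GF2 k"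
    using assms(2) by simp
  then show ?thesis
    by (rule imageE) (use that in simp)
qed

text \<open>
  Squaring shifts the sum of conjugates cyclically, so that sum is a root of \<open>t\<^sup>2 = t\<close>. This is what
  makes the trace land in the prime field, where \<open>of_ac\<close> is meaningful.
\<close>

lemma conjugate_sum:
  assumes "x \<in> GF2 k"
  shows "(\<Sum>i<k. x ^ (2 ^ i)) \<in> range to_ac"
    and "(\<Sum>i<k. (x\<^sup>2) ^ (2 ^ i)) = (\<Sum>i<k. x ^ (2 ^ i))"
proof -
  have "(\<Sum>i<k. (x\<^sup>2) ^ (2 ^ i)) = (\<Sum>i<k. x ^ (2 ^ Suc i))"
    by (simp add: power_mult[symmetric])
  also have "\<dots> + x = (\<Sum>i<Suc k. x ^ (2 ^ i))"
    by (subst sum.lessThan_Suc_shift) (simp add: add.commute)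
  also have "\<dots> = (\<Sum>i<k. x ^ (2 ^ i)) + x"
    using assms by (simp add: GF2_def)
  finally show *: "(\<Sum>i<k. (x\<^sup>2) ^ (2 ^ i)) = (\<Sum>i<k. x ^ (2 ^ i))"
    by simp
  define t where "t = (\<Sum>i<k. x ^ (2 ^ i))"
  have "t ^ (2 ^ 1) = t"
    unfolding t_def frobenius_sum using * by (simp add: power_mult[symmetric] mult.commute)
  then have "t * t = t * 1"
    by (simp add: power2_eq_square)
  then have "t = to_ac 0 \<or> t = to_ac 1"
    by (simp only: mult_cancel_left to_ac_0 to_ac_1)
  then show "(\<Sum>i<k. x ^ (2 ^ i)) \<in> range to_ac"
    unfolding t_def by blast
qed

lemma to_ac_trace: "x \<in> GF2 k \<Longrightarrow> to_ac (trace_F2 k x) = (\<Sum>i<k. x ^ (2 ^ i))"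
  unfolding trace_F2_def by (rule to_ac_of_ac) (rule conjugate_sum)

lemma trace_add:
  "x \<in> GF2 k \<Longrightarrow> y \<in> GF2 k \<Longrightarrow> trace_F2 k (x + y) = trace_F2 k x + trace_F2 k y"
  by (subst to_ac_eq_iff[symmetric]) (simp only: to_ac_add to_ac_trace GF2_add frobenius_add sum.distrib)

lemma trace_0 [simp]: "trace_F2 k 0 = 0"
  by (simp add: trace_F2_def power_0_left)

lemma trace_sum:
  "(\<And>i. i \<in> A \<Longrightarrow> g i \<in> GF2 k) \<Longrightarrow> trace_F2 k (\<Sum>i\<in>A. g i) = (\<Sum>i\<in>A. trace_F2 k (g i))"
  by (induction A rule: infinite_finite_induct) (simp_all add: trace_add GF2_sum)

lemma trace_frobenius: "x \<in> GF2 k \<Longrightarrow> trace_F2 k (x ^ (2 ^ j)) = trace_F2 k x"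
proof (induction j)
  case (Suc j)
  have "trace_F2 k ((x ^ (2 ^ j))\<^sup>2) = trace_F2 k (x ^ (2 ^ j))"
    using Suc.prems by (simp add: trace_F2_def conjugate_sum(2))
  then show ?case
    using Suc by (simp add: power_mult[symmetric] mult.commute)
qed simp

text \<open>
  Otherwise the trace vanishes on all \<open>2 ^ k\<close> elements of \<open>GF2 k\<close>, although it is a nonzero polynomial
  function of degree \<open>2 ^ (k - 1)\<close>.
\<close>

lemma trace_nondegenerate:
  assumes k: "k \<ge> 1" and w: "w \<in> GF2 k" and zero: "\<And>z. z \<in> GF2 k \<Longrightarrow> trace_F2 k (z * w) = 0"
  shows "w = 0"
proof (rule ccontr)
  assume "w \<noteq> 0"
  define p :: "F2bar poly" where "p = (\<Sum>i<k. monom 1 (2 ^ i))"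
  have "coeff p 1 = (\<Sum>i<k. if i = 0 then 1 else 0)"
    unfolding p_def coeff_sum by (intro sum.cong) auto
  then have "p \<noteq> 0"
    using k by (auto simp: Suc_le_eq)
  have "degree p \<le> 2 ^ (k - 1)"
    unfolding p_def by (rule degree_sum_le) (auto intro!: order.trans[OF degree_monom_le])
  moreover have "GF2 k \<subseteq> {x. poly p x = 0}"
  proof safe
    fix x assume x: "x \<in> GF2 k"
    then have "trace_F2 k (x / w * w) = 0"
      by (intro zero) (use w in auto)
    then show "poly p x = 0"
      using \<open>w \<noteq> 0\<close> to_ac_trace[OF x] by (simp add: p_def poly_sum poly_monom)
  qed
  then have "card (GF2 k) \<le> degree p"
    using card_mono poly_roots_finite[OF \<open>p \<noteq> 0\<close>] card_poly_roots_bound[OF \<open>p \<noteq> 0\<close>] order.trans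
    by blast
  ultimately have "(2::nat) ^ k \<le> 2 ^ (k - 1)"
    using card_GF2[OF k] by linarith
  then show False
    using k by simp
qed


section \<open>The quadratic form attached to an additive polynomial\<close>

text \<open>
  For fixed \<open>x\<close> one has \<open>Tr (x R(y) + y R(x)) = Tr (y (R(x) + R\<^sup>*(x)))\<close>, where \<open>R\<^sup>*\<close> is the adjoint
  of \<open>R\<close> for the trace form. This polynomial is the \<open>2 ^ d\<close>-th power of \<open>R(x) + R\<^sup>*(x)\<close>; that power
  clears the inverse Frobenius maps in \<open>R\<^sup>*\<close>.
\<close>

definition radical_poly :: "nat \<Rightarrow> (nat \<Rightarrow> F2bar) \<Rightarrow> F2bar poly" where
  "radical_poly d \<alpha> = (\<Sum>i\<le>d. monom (\<alpha> i ^ (2 ^ d)) (2 ^ (d + i))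
                       + monom (\<alpha> i ^ (2 ^ (d - i))) (2 ^ (d - i)))"

definition quad_poly :: "nat \<Rightarrow> (nat \<Rightarrow> F2bar) \<Rightarrow> F2bar poly" where
  "quad_poly d \<alpha> = monom 1 1 * (\<Sum>i\<le>d. monom (\<alpha> i) (2 ^ i))"

lemma poly_radical_poly:
  "poly (radical_poly d \<alpha>) x =
     (\<Sum>i\<le>d. \<alpha> i ^ (2 ^ d) * x ^ (2 ^ (d + i)) + \<alpha> i ^ (2 ^ (d - i)) * x ^ (2 ^ (d - i)))"
  by (simp add: radical_poly_def poly_sum poly_monom)

lemma poly_quad_poly: "poly (quad_poly d \<alpha>) x = (\<Sum>i\<le>d. \<alpha> i * x ^ (2 ^ i) * x)"
  by (simp add: quad_poly_def poly_sum poly_monom sum_distrib_left mult_ac)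

lemma radical_poly_add:
  "poly (radical_poly d \<alpha>) (x + y) = poly (radical_poly d \<alpha>) x + poly (radical_poly d \<alpha>) y"
  by (simp add: poly_radical_poly frobenius_add sum.distrib distrib_left ac_simps)

text \<open>
  The polarisation is \<open>Tr (\<Sum> \<alpha>\<^sub>i x\<^bsup>2^i\<^esup> y + \<alpha>\<^sub>i y\<^bsup>2^i\<^esup> x)\<close>. The trace is invariant under Frobenius;
  raising the first term to the power \<open>2 ^ d\<close> and the second one to the power \<open>2 ^ (d - i)\<close> turns
  every occurrence of \<open>y\<close> into \<open>y\<^bsup>2^d\<^esup>\<close>.
\<close>

lemma polar_trace:
  assumes \<alpha>: "\<And>i. i \<le> d \<Longrightarrow> \<alpha> i \<in> GF2 k" and xy: "x \<in> GF2 k" "y \<in> GF2 k"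
  shows "polar (\<lambda>x. trace_F2 k (poly (quad_poly d \<alpha>) x)) x y =
      trace_F2 k (y ^ (2 ^ d) * poly (radical_poly d \<alpha>) x)"
proof -
  have mem: "poly (quad_poly d \<alpha>) z \<in> GF2 k" if "z \<in> GF2 k" for z
    unfolding poly_quad_poly by (rule GF2_sum) (use that \<alpha> in auto)
  have "polar (\<lambda>x. trace_F2 k (poly (quad_poly d \<alpha>) x)) x y =
      trace_F2 k (poly (quad_poly d \<alpha>) (x + y) + poly (quad_poly d \<alpha>) x + poly (quad_poly d \<alpha>) y)"
    using xy by (simp add: polar_def trace_add mem)
  also have "poly (quad_poly d \<alpha>) (x + y) + poly (quad_poly d \<alpha>) x + poly (quad_poly d \<alpha>) y =
      (\<Sum>i\<le>d. \<alpha> i * x ^ (2 ^ i) * y + \<alpha> i * y ^ (2 ^ i) * x)"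
    unfolding poly_quad_poly sum.distrib[symmetric]
  proof (rule sum.cong[OF refl])
    fix i
    \<comment> \<open>The diagonal terms occur twice and cancel in characteristic two.\<close>
    have "\<alpha> i * (x + y) ^ 2 ^ i * (x + y) + \<alpha> i * x ^ 2 ^ i * x + \<alpha> i * y ^ 2 ^ i * y =
        (\<alpha> i * x ^ 2 ^ i * y + \<alpha> i * y ^ 2 ^ i * x)
        + ((\<alpha> i * x ^ 2 ^ i * x + \<alpha> i * x ^ 2 ^ i * x) + (\<alpha> i * y ^ 2 ^ i * y + \<alpha> i * y ^ 2 ^ i * y))"
      by (simp only: frobenius_add distrib_left distrib_right ac_simps)
    then show "\<alpha> i * (x + y) ^ 2 ^ i * (x + y) + \<alpha> i * x ^ 2 ^ i * x + \<alpha> i * y ^ 2 ^ i * y =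
        \<alpha> i * x ^ 2 ^ i * y + \<alpha> i * y ^ 2 ^ i * x"
      by (simp only: add_self add_0_right)
  qed
  also have "trace_F2 k \<dots> =
      (\<Sum>i\<le>d. trace_F2 k (\<alpha> i * x ^ (2 ^ i) * y) + trace_F2 k (\<alpha> i * y ^ (2 ^ i) * x))"
    by (subst trace_sum) (use \<alpha> xy in \<open>auto simp: trace_add\<close>)
  also have "\<dots> = (\<Sum>i\<le>d. trace_F2 k (y ^ (2 ^ d) * (\<alpha> i ^ (2 ^ d) * x ^ (2 ^ (d + i))))
      + trace_F2 k (y ^ (2 ^ d) * (\<alpha> i ^ (2 ^ (d - i)) * x ^ (2 ^ (d - i)))))"
  proof (rule sum.cong[OF refl], rule arg_cong2[of _ _ _ _ "(+)"])
    fix i assume i: "i \<in> {..d}"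
    have "trace_F2 k (\<alpha> i * x ^ (2 ^ i) * y) = trace_F2 k ((\<alpha> i * x ^ (2 ^ i) * y) ^ (2 ^ d))"
      by (rule trace_frobenius[symmetric]) (use i \<alpha> xy in auto)
    also have "(\<alpha> i * x ^ (2 ^ i) * y) ^ (2 ^ d) = y ^ (2 ^ d) * (\<alpha> i ^ (2 ^ d) * x ^ (2 ^ (d + i)))"
      by (simp add: power_mult_distrib power_mult[symmetric] power_add[symmetric] ac_simps)
    finally show "trace_F2 k (\<alpha> i * x ^ (2 ^ i) * y) =
        trace_F2 k (y ^ (2 ^ d) * (\<alpha> i ^ (2 ^ d) * x ^ (2 ^ (d + i))))" .
    have "trace_F2 k (\<alpha> i * y ^ (2 ^ i) * x) = trace_F2 k ((\<alpha> i * y ^ (2 ^ i) * x) ^ (2 ^ (d - i)))"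
      by (rule trace_frobenius[symmetric]) (use i \<alpha> xy in auto)
    also have "(\<alpha> i * y ^ (2 ^ i) * x) ^ (2 ^ (d - i)) =
        y ^ (2 ^ d) * (\<alpha> i ^ (2 ^ (d - i)) * x ^ (2 ^ (d - i)))"
      using i by (simp add: power_mult_distrib power_mult[symmetric] power_add[symmetric] ac_simps)
    finally show "trace_F2 k (\<alpha> i * y ^ (2 ^ i) * x) =
        trace_F2 k (y ^ (2 ^ d) * (\<alpha> i ^ (2 ^ (d - i)) * x ^ (2 ^ (d - i))))" .
  qed
  also have "\<dots> = trace_F2 k (y ^ (2 ^ d) * poly (radical_poly d \<alpha>) x)"
    unfolding poly_radical_poly sum_distrib_left
    by (subst trace_sum) (use \<alpha> xy in \<open>auto simp: trace_add distrib_left\<close>)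
  finally show ?thesis .
qed

lemma radical_trace:
  assumes \<alpha>: "\<And>i. i \<le> d \<Longrightarrow> \<alpha> i \<in> GF2 k" and k: "k \<ge> 1"
  shows "radical (GF2 k) (\<lambda>x. trace_F2 k (poly (quad_poly d \<alpha>) x)) =
      {x \<in> GF2 k. poly (radical_poly d \<alpha>) x = 0}"
proof -
  have "poly (radical_poly d \<alpha>) x = 0"
    if x: "x \<in> GF2 k" and orth: "\<forall>y\<in>GF2 k. trace_F2 k (y ^ (2 ^ d) * poly (radical_poly d \<alpha>) x) = 0" for x
  proof (rule trace_nondegenerate[OF k])
    show "poly (radical_poly d \<alpha>) x \<in> GF2 k"
      unfolding poly_radical_poly by (rule GF2_sum) (use x \<alpha> in auto)
    fix z assume "z \<in> GF2 k"
    then obtain y where "y \<in> GF2 k" "y ^ (2 ^ d) = z"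
      using GF2_frobenius_onto[OF k] by blast
    then show "trace_F2 k (z * poly (radical_poly d \<alpha>) x) = 0"
      using orth by blast
  qed
  then show ?thesis
    by (auto simp: radical_def polar_trace[of d \<alpha> k, OF \<alpha>])
qed

text \<open>
  All exponents are powers of two, so only the exponent \<open>2 ^ 0\<close>, from the second summand at
  \<open>i = d\<close>, contributes to the derivative. The derivative is the nonzero constant \<open>\<alpha> d\<close>, and the
  polynomial is separable of degree \<open>2 ^ (2 * d)\<close>.
\<close>

lemma card_roots_radical_poly:
  assumes "d \<ge> 1" and "\<alpha> d \<noteq> 0"
  shows "card {x. poly (radical_poly d \<alpha>) x = 0} = 2 ^ (2 * d)"
proof -
  have coeff_top: "coeff (radical_poly d \<alpha>) (2 ^ (2 * d)) = \<alpha> d ^ (2 ^ d)"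
  proof -
    have "coeff (radical_poly d \<alpha>) (2 ^ (2 * d)) = (\<Sum>i\<le>d. if i = d then \<alpha> d ^ (2 ^ d) else 0)"
      unfolding radical_poly_def coeff_sum coeff_add coeff_monom
      by (intro sum.cong) (use assms(1) in \<open>auto simp: power_inject_exp\<close>)
    then show ?thesis
      by simp
  qed
  have "degree (radical_poly d \<alpha>) \<le> 2 ^ (2 * d)"
    unfolding radical_poly_def
    by (intro degree_sum_le degree_add_le order.trans[OF degree_monom_le] power_increasing) auto
  moreover have "degree (radical_poly d \<alpha>) \<ge> 2 ^ (2 * d)"
    by (rule le_degree) (use coeff_top assms in simp)
  ultimately have deg: "degree (radical_poly d \<alpha>) = 2 ^ (2 * d)"
    by simp
  have "pderiv (radical_poly d \<alpha>) = (\<Sum>i\<le>d. if i = d then [:\<alpha> d:] else 0)"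
    unfolding radical_poly_def higher_pderiv_sum[of 1, simplified] pderiv_add pderiv_monom
    by (intro sum.cong)
       (use assms(1) in \<open>auto simp: power_0_left two_eq_0 monom_0\<close>)
  then have "pderiv (radical_poly d \<alpha>) = [:\<alpha> d:]"
    by simp
  then show ?thesis
    using card_roots_eq_degree[of "radical_poly d \<alpha>"] assms deg coeff_top by force
qed

section \<open>The exponential sums as power sums of reciprocal roots\<close>

text \<open>
  A fact \<open>P' = P * H\<close> says that \<open>H\<close> is the logarithmic derivative of \<open>P\<close>. In this division-free form it
  turns products into sums for arbitrary power series.
\<close>

lemma log_deriv_prod:
  fixes P H :: "'i \<Rightarrow> complex fps"
  assumes "\<And>i. i \<in> A \<Longrightarrow> fps_deriv (P i) = P i * H i"
  shows "fps_deriv (\<Prod>i\<in>A. P i) = (\<Prod>i\<in>A. P i) * (\<Sum>i\<in>A. H i)"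
  using assms
  by (induction A rule: infinite_finite_induct) (simp_all add: algebra_simps)

lemma log_deriv_power:
  fixes P H :: "complex fps"
  assumes "fps_deriv P = P * H"
  shows "fps_deriv (P ^ n) = P ^ n * (of_nat n * H)"
  using log_deriv_prod[of "{..<n}" "\<lambda>_. P" "\<lambda>_. H"] assms by simp

lemma log_deriv_linear:
  "fps_deriv (fps_of_poly [:1, - w:]) = fps_of_poly [:1, - w:] * Abs_fps (\<lambda>n. - (w ^ Suc n :: complex))"
proof (rule fps_ext)
  fix n
  have eq: "fps_of_poly [:1, - w:] = 1 - fps_X * fps_const w"
    by (simp add: fps_of_poly_pCons mult.commute)
  show "fps_nth (fps_deriv (fps_of_poly [:1, - w:])) n =
      fps_nth (fps_of_poly [:1, - w:] * Abs_fps (\<lambda>n. - (w ^ Suc n))) n"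
    unfolding eq by (cases n) (simp_all add: left_diff_distrib mult.assoc)
qed

lemma log_deriv_cyclotomic:
  "fps_deriv (fps_of_poly (cyclotomic l)) =
     fps_of_poly (cyclotomic l) * Abs_fps (\<lambda>n. - ramanujan_sum l (Suc n))"
proof -
  have "fps_deriv (\<Prod>i\<in>totatives l. fps_of_poly [:1, - (zeta l ^ i):]) =
      (\<Prod>i\<in>totatives l. fps_of_poly [:1, - (zeta l ^ i):]) *
      (\<Sum>i\<in>totatives l. Abs_fps (\<lambda>n. - ((zeta l ^ i) ^ Suc n)))"
    by (rule log_deriv_prod) (rule log_deriv_linear)
  also have "(\<Sum>i\<in>totatives l. Abs_fps (\<lambda>n. - ((zeta l ^ i) ^ Suc n))) =
      Abs_fps (\<lambda>n. - ramanujan_sum l (Suc n))"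
    by (rule fps_ext)
       (simp add: fps_sum_nth ramanujan_sum_def sum_negf power_mult[symmetric] mult.commute del: power_Suc mult_Suc_right mult_Suc)
  finally show ?thesis
    by (simp add: cyclotomic_def fps_of_poly_prod)
qed

lemma log_deriv_L_star:
  "fps_deriv (L_star m f) = L_star m f * Abs_fps (\<lambda>n. exp_sum_star m f (Suc n))"
proof -
  define F where "F = Abs_fps (\<lambda>n. if n = 0 then 0 else of_int (exp_sum m f n) / of_nat n :: complex)"
  define c where "c = 1 / complex_of_real (sqrt 2) ^ m"
  define Y where "Y = fps_const c * fps_X"
  have "fps_deriv (L_fun m f) = L_fun m f * fps_deriv F"
    unfolding L_fun_def F_def[symmetric] by (subst fps_compose_deriv) (simp_all add: F_def)
  then have "fps_deriv (L_star m f) = (L_fun m f * fps_deriv F oo Y) * fps_deriv Y"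
    unfolding L_star_def c_def[symmetric] Y_def[symmetric]
    by (subst fps_compose_deriv) (simp_all add: Y_def)
  also have "\<dots> = L_star m f * ((fps_deriv F oo Y) * fps_const c)"
    unfolding L_star_def c_def[symmetric] Y_def[symmetric]
    by (subst fps_compose_mult_distrib) (simp_all add: Y_def mult.assoc)
  also have "(fps_deriv F oo Y) * fps_const c = Abs_fps (\<lambda>n. exp_sum_star m f (Suc n))"
  proof (rule fps_ext)
    fix n
    have "c ^ Suc n = 1 / complex_of_real (sqrt 2) ^ (m * Suc n)"
      by (simp add: c_def power_one_over power_mult del: power_Suc mult_Suc_right)
    moreover have "fps_nth ((fps_deriv F oo Y) * fps_const c) n = c ^ Suc n * of_int (exp_sum m f (Suc n))"
      unfolding Y_def by (simp add: F_def del: of_nat_Suc)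
    ultimately show "fps_nth ((fps_deriv F oo Y) * fps_const c) n = fps_nth (Abs_fps (\<lambda>n. exp_sum_star m f (Suc n))) n"
      by (simp add: exp_sum_star_def)
  qed
  finally show ?thesis .
qed

definition cyclotomic_support :: "(nat \<Rightarrow> nat) \<Rightarrow> nat set" where
  "cyclotomic_support \<mu> = {l. l \<ge> 1 \<and> \<mu> l \<noteq> 0}"

text \<open>
  Comparison of the logarithmic derivatives of the two sides of the cyclotomic factorisation: the
  coefficients of the left one are the normalised sums, those of a factor \<open>\<Phi>\<^sub>l\<close> are the
  negative power sums \<open>- c\<^sub>l(n)\<close> of its reciprocal roots.
\<close>

lemma exp_sum_star_eq_ramanujan:
  assumes \<mu>: "cyclotomic_multiplicities (L_star m f) \<mu>" and "n \<ge> 1"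
  shows "exp_sum_star m f n = - (\<Sum>l\<in>cyclotomic_support \<mu>. of_nat (\<mu> l) * ramanujan_sum l n)"
proof -
  let ?S = "cyclotomic_support \<mu>"
  define H where "H = (\<lambda>l. of_nat (\<mu> l) * Abs_fps (\<lambda>n. - ramanujan_sum l (Suc n)))"
  have P: "L_star m f = (\<Prod>l\<in>?S. fps_of_poly (cyclotomic l) ^ \<mu> l)"
    using \<mu> by (simp add: cyclotomic_multiplicities_def cyclotomic_support_def fps_of_poly_prod fps_of_poly_power)
  have "cyclotomic l \<noteq> 0" for l
    by (simp add: cyclotomic_def)
  then have "L_star m f \<noteq> 0"
    using \<mu> by (simp add: P cyclotomic_multiplicities_def cyclotomic_support_def)
  have "fps_deriv (L_star m f) = L_star m f * (\<Sum>l\<in>?S. H l)"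
    unfolding P H_def by (intro log_deriv_prod log_deriv_power log_deriv_cyclotomic)
  then have "Abs_fps (\<lambda>n. exp_sum_star m f (Suc n)) = (\<Sum>l\<in>?S. H l)"
    using \<open>L_star m f \<noteq> 0\<close> by (simp add: log_deriv_L_star)
  then have "fps_nth (Abs_fps (\<lambda>n. exp_sum_star m f (Suc n))) (n - 1) = fps_nth (\<Sum>l\<in>?S. H l) (n - 1)"
    by simp
  then show ?thesis
    using \<open>n \<ge> 1\<close> by (simp add: H_def fps_sum_nth fps_of_nat[symmetric] sum_negf)
qed


section \<open>Ramanujan sums\<close>

lemma norm_zeta [simp]: "norm (zeta l) = 1"
  by (simp add: zeta_def)

lemma zeta_power: "zeta l ^ k = cis (2 * pi * real k / real l)"
  by (simp add: zeta_def Complex.DeMoivre mult_ac)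

lemma zeta_power_self [simp]: "l \<ge> 1 \<Longrightarrow> zeta l ^ l = 1"
  by (simp add: zeta_power)

lemma zeta_power_mod: "l \<ge> 1 \<Longrightarrow> zeta l ^ (k mod l) = zeta l ^ k"
  by (subst (2) div_mult_mod_eq[of k l, symmetric], subst power_add) (simp add: power_mult mult.commute[of _ l])

lemma zeta_power_cong: "l \<ge> 1 \<Longrightarrow> [j = k] (mod l) \<Longrightarrow> zeta l ^ j = zeta l ^ k"
  by (metis cong_def zeta_power_mod)

lemma zeta_power_eq_1_iff:
  assumes "l \<ge> 1" shows "zeta l ^ k = 1 \<longleftrightarrow> l dvd k"
proof
  assume "zeta l ^ k = 1"
  then have "zeta l ^ (k mod l) = zeta l ^ 0"
    using assms by (simp add: zeta_power_mod)
  then have "cis (2 * pi * real (k mod l) / real l) = cis (2 * pi * real 0 / real l)"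
    by (simp only: zeta_power)
  then have "k mod l = 0"
    using inj_onD[OF bij_betw_imp_inj_on[OF bij_betw_roots_unity[of l]], of "k mod l" 0] assms by simp
  then show "l dvd k" by auto
qed (use assms in \<open>auto simp: power_mult elim!: dvdE\<close>)

lemma ramanujan_sum_dvd:
  assumes "l \<ge> 1" "l dvd n" shows "ramanujan_sum l n = of_nat (totient l)"
proof -
  have "zeta l ^ n = 1"
    using assms by (simp add: zeta_power_eq_1_iff)
  then show ?thesis
    by (simp add: ramanujan_sum_def power_mult totient_def)
qed

text \<open>
  Equality in the triangle inequality: a sum of \<open>D\<close> complex numbers of absolute value 1 equals
  \<open>s * D\<close> only if each of them is \<open>s\<close>. Here they are the \<open>n\<close>-th powers of roots of unity. The quantity \<open>gap l\<close>
  measures how much the primitive \<open>l\<close>-th roots fall short of this; it is nonnegative, and the weighted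
  gaps add up to 0.
\<close>

lemma zeta_power_eq_if_sum_extremal:
  fixes s :: complex
  assumes s: "s = 1 \<or> s = -1" and "finite S" and S: "\<And>l. l \<in> S \<Longrightarrow> l \<ge> 1 \<and> \<mu> l \<noteq> 0"
    and eq: "(\<Sum>l\<in>S. of_nat (\<mu> l) * ramanujan_sum l n) = s * of_nat (\<Sum>l\<in>S. \<mu> l * totient l)"
    and l: "l \<in> S"
  shows "zeta l ^ n = s"
proof -
  have s': "s * s = 1" "norm s = 1"
    using s by auto
  have le: "Re (s * zeta l ^ (n * i)) \<le> 1" for l i
    using complex_Re_le_cmod[of "s * zeta l ^ (n * i)"] s' by (simp add: norm_mult norm_power)
  define gap where "gap = (\<lambda>l. \<Sum>i\<in>totatives l. 1 - Re (s * zeta l ^ (n * i)))"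
  have gap_nonneg: "gap l \<ge> 0" for l
    unfolding gap_def using le by (intro sum_nonneg) (simp add: algebra_simps)
  have gap_eq: "gap l = real (totient l) - Re (s * ramanujan_sum l n)" for l
    by (simp add: gap_def sum_subtractf ramanujan_sum_def totient_def sum_distrib_left Re_sum)
  have "(\<Sum>l\<in>S. of_nat (\<mu> l) * (s * ramanujan_sum l n)) = s * (\<Sum>l\<in>S. of_nat (\<mu> l) * ramanujan_sum l n)"
    by (simp add: sum_distrib_left mult_ac)
  also have "\<dots> = of_nat (\<Sum>l\<in>S. \<mu> l * totient l)"
    unfolding eq mult.assoc[symmetric] s' by simp
  finally have "(\<Sum>l\<in>S. real (\<mu> l) * Re (s * ramanujan_sum l n)) = (\<Sum>l\<in>S. real (\<mu> l) * real (totient l))"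
    by (subst (asm) complex_eq_iff) (simp add: Re_sum)
  then have "(\<Sum>l\<in>S. real (\<mu> l) * gap l) = 0"
    by (simp add: gap_eq right_diff_distrib sum_subtractf)
  then have "\<forall>l\<in>S. real (\<mu> l) * gap l = 0"
    by (subst (asm) sum_nonneg_eq_0_iff) (use \<open>finite S\<close> gap_nonneg in auto)
  then have "real (\<mu> l) * gap l = 0"
    using l by blast
  then have "gap l = 0"
    using S[OF l] by simp
  then have "\<forall>i\<in>totatives l. 1 - Re (s * zeta l ^ (n * i)) = 0"
    unfolding gap_def by (subst (asm) sum_nonneg_eq_0_iff) (use le in \<open>auto simp: algebra_simps\<close>)
  moreover have "1 \<in> totatives l"
    using S[OF l] by (simp add: in_totatives_iff)
  ultimately have Re1: "Re (s * zeta l ^ n) = 1"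
    by force
  moreover have "norm (s * zeta l ^ n) = 1"
    using s' by (simp add: norm_mult norm_power)
  ultimately have "Im (s * zeta l ^ n) = 0"
    by (simp add: cmod_def)
  with Re1 have "s * zeta l ^ n = 1"
    by (simp add: complex_eq_iff)
  then have "s * (s * zeta l ^ n) = s"
    by simp
  then show ?thesis
    unfolding mult.assoc[symmetric] s' by simp
qed

text \<open>
  The order \<open>l\<close> divides \<open>2 ^ (a + 1) * N'\<close> but not \<open>2 ^ a * N'\<close>, so its 2-part is exactly
  \<open>2 ^ (a + 1)\<close>.
\<close>

lemma eq_two_power_times_divisor:
  assumes l: "l \<ge> 1" and odd: "odd N'" and z: "zeta l ^ (2 ^ a * N') = -1"
  obtains l' where "l' dvd N'" "l = 2 ^ (a + 1) * l'"
proof -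
  have ndvd: "\<not> l dvd 2 ^ a * N'"
    using z zeta_power_eq_1_iff[OF l, of "2 ^ a * N'"] by auto
  have "zeta l ^ (2 ^ a * N' * 2) = (-1)\<^sup>2"
    by (subst power_mult) (simp only: z)
  then have "l dvd 2 ^ a * N' * 2"
    using zeta_power_eq_1_iff[OF l] by simp
  then have "l dvd 2 ^ (a + 1) * N'"
    by (simp add: mult_ac)
  then obtain u v where uv: "l = u * v" "u dvd 2 ^ (a + 1)" "v dvd N'"
    using division_decomp[of l "2 ^ (a + 1)" N'] by blast
  then obtain j where j: "j \<le> a + 1" "u = 2 ^ j"
    using divides_primepow_nat[OF two_is_prime_nat] by blast
  have "j = a + 1"
  proof (rule ccontr)
    assume "j \<noteq> a + 1"
    then have "u dvd 2 ^ a"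
      using j by (simp add: le_imp_power_dvd)
    with uv ndvd show False
      by (simp add: mult_dvd_mono)
  qed
  with uv j that show ?thesis
    by blast
qed

lemma bij_betw_totatives_mult:
  assumes "coprime h l" "l > 1"
  shows "bij_betw (\<lambda>i. h * i mod l) (totatives l) (totatives l)"
proof -
  have inj: "inj_on (\<lambda>i. h * i mod l) (totatives l)"
  proof (rule inj_onI)
    fix i j assume ij: "i \<in> totatives l" "j \<in> totatives l" "h * i mod l = h * j mod l"
    then have "[i = j] (mod l)"
      using cong_mult_lcancel_nat[OF assms(1)] by (simp add: cong_def)
    then show "i = j"
      using ij(1,2) assms(2) by (simp add: cong_def totatives_less)
  qed
  have "(\<lambda>i. h * i mod l) ` totatives l \<subseteq> totatives l"
  proof safe
    fix i assume "i \<in> totatives l"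
    then have "coprime (h * i) l"
      using assms by (simp add: in_totatives_iff)
    then have "coprime (h * i mod l) l"
      using assms(2) by simp
    moreover from this have "h * i mod l \<noteq> 0"
      using assms(2) by (intro notI) simp
    moreover have "h * i mod l < l"
      using assms(2) by simp
    ultimately show "h * i mod l \<in> totatives l"
      by (simp add: in_totatives_iff)
  qed
  then show ?thesis
    using inj by (simp add: bij_betw_def endo_inj_surj)
qed

lemma ramanujan_sum_coprime_mult:
  assumes "l \<ge> 1" "coprime h l"
  shows "(\<Sum>i\<in>totatives l. zeta l ^ (n * (h * i))) = ramanujan_sum l n"
proof (cases "l = 1")
  case True
  then show ?thesis
    using zeta_power_eq_1_iff[of 1] by (simp add: ramanujan_sum_def)
next
  case False
  have "ramanujan_sum l n = (\<Sum>i\<in>totatives l. zeta l ^ (n * (h * i mod l)))"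
    unfolding ramanujan_sum_def
    by (rule sum.reindex_bij_betw[symmetric, OF bij_betw_totatives_mult]) (use assms False in auto)
  also have "\<dots> = (\<Sum>i\<in>totatives l. zeta l ^ (n * (h * i)))"
    by (rule sum.cong[OF refl], rule zeta_power_cong) (use assms in \<open>auto simp: cong_def mod_mult_right_eq\<close>)
  finally show ?thesis ..
qed

text \<open>
  By the Chinese remainder theorem each unit modulo \<open>l\<close> lifts to as many units modulo \<open>q * l\<close> as there
  are units modulo \<open>q\<close>.
\<close>

lemma sum_totatives_mult:
  fixes g :: "nat \<Rightarrow> complex"
  assumes cop: "coprime q l" and "q > 1" and l: "l \<ge> 1" and g: "\<And>i. g (i mod l) = g i"
  shows "(\<Sum>i\<in>totatives (q * l). g i) = of_nat (totient q) * (\<Sum>i\<in>totatives l. g i)"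
proof (cases "l = 1")
  case True
  then have "g i = g 0" for i
    using g[of i] by simp
  then have "g = (\<lambda>_. g 0)" by blast
  then have "(\<Sum>i\<in>totatives q. g i) = of_nat (totient q) * g 1"
    by (metis sum_constant totient_def)
  then show ?thesis
    using True by simp
next
  case False
  then have "(\<Sum>i\<in>totatives (q * l). g (snd (i mod q, i mod l))) = (\<Sum>p\<in>totatives q \<times> totatives l. g (snd p))"
    by (intro sum.reindex_bij_betw[OF bij_betw_totatives]) (use assms in auto)
  also have "\<dots> = (\<Sum>x\<in>totatives q. \<Sum>i\<in>totatives l. g i)"
    by (subst sum.cartesian_product) (simp add: case_prod_unfold)
  finally show ?thesis
    by (simp add: g totient_def)
qed

text \<open>
  With \<open>h\<close> the inverse of 2 modulo \<open>l\<close>, one has \<open>\<zeta>\<^bsub>2l\<^esub> = - \<zeta>\<^sub>l\<^bsup>h\<^esup>\<close>, so for odd \<open>d\<close> and \<open>i\<close>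
  every term on the left is \<open>- \<zeta>\<^sub>l\<^bsup>hdi\<^esup>\<close>. It depends on \<open>i\<close> modulo \<open>l\<close> only; by the Chinese remainder
  theorem each unit modulo \<open>l\<close> is hit \<open>\<phi>(2 ^ (a + 1)) = 2 ^ a\<close> times, and multiplication by \<open>h\<close> permutes
  these units.
\<close>

lemma ramanujan_sum_two_power:
  assumes "odd l" "odd d"
  shows "ramanujan_sum (2 ^ (a + 1) * l) (2 ^ a * d) = - (2 ^ a) * ramanujan_sum l d"
proof -
  have l: "l \<ge> 1"
    using assms(1) by (cases l) auto
  define h where "h = (l + 1) div 2"
  have h: "2 * h = l + 1"
    using assms(1) by (simp add: h_def)
  have "coprime (2 * h) l"
    by (simp add: h coprime_add_one_left)
  then have "coprime h l"
    by simp
  have zeta_2l: "zeta (2 ^ (a + 1) * l) ^ (2 ^ a * d * i) = - (zeta l ^ (d * (h * i)))" if "odd i" for i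
  proof -
    have "zeta l ^ (d * (h * i)) = cis (2 * pi * real (2 * h * d * i) / real (2 * l))"
      using l by (simp add: zeta_power field_simps)
    also have "real (2 * h * d * i) = real l * real (d * i) + real (d * i)"
      unfolding h by (simp add: algebra_simps)
    also have "2 * pi * (real l * real (d * i) + real (d * i)) / real (2 * l) =
        pi * real (d * i) + 2 * pi * real (2 ^ a * d * i) / real (2 ^ (a + 1) * l)"
      using l by (simp add: field_simps)
    also have "cis \<dots> = cis pi ^ (d * i) * zeta (2 ^ (a + 1) * l) ^ (2 ^ a * d * i)"
      unfolding zeta_power Complex.DeMoivre cis_mult by (simp only: mult.commute[of pi])
    also have "cis pi ^ (d * i) = -1"
      using assms(2) that by (simp add: cis_pi)
    finally show ?thesis by simp
  qed
  have "ramanujan_sum (2 ^ (a + 1) * l) (2 ^ a * d) = (\<Sum>i\<in>totatives (2 ^ (a + 1) * l). - (zeta l ^ (d * (h * i))))"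
    unfolding ramanujan_sum_def
    by (rule sum.cong[OF refl], rule zeta_2l) (auto simp: in_totatives_iff)
  also have "\<dots> = of_nat (totient (2 ^ (a + 1))) * (\<Sum>i\<in>totatives l. - (zeta l ^ (d * (h * i))))"
  proof (rule sum_totatives_mult)
    show "coprime (2 ^ (a + 1)) l"
      using assms(1) by simp
    show "- (zeta l ^ (d * (h * (i mod l)))) = - (zeta l ^ (d * (h * i)))" for i
      unfolding neg_equal_iff_equal
      by (rule zeta_power_cong) (use l in \<open>auto simp: cong_def mod_mult_right_eq intro!: mod_mult_cong\<close>)
    show "2 ^ (a + 1) > (1::nat)"
      by (rule one_less_power) simp_all
  qed (use l in auto)
  also have "totient (2 ^ (a + 1)) = 2 ^ a"
    using totient_prime_power_Suc[OF two_is_prime_nat, of a] by simp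
  finally show ?thesis
    using ramanujan_sum_coprime_mult[OF l \<open>coprime h l\<close>, of d] by (simp add: sum_negf)
qed

section \<open>The sums at multiples of the splitting degree\<close>

lemma exp_sum_bit_sign: "exp_sum m f n = (\<Sum>x\<in>GF2 (m * n). bit_sign (trace_F2 (m * n) (poly f x)))"
  by (simp add: exp_sum_def bit_sign_def)

lemma diff_eq_add: "x - y = x + (y :: F2bar)"
  using add_uminus_conv_diff[of x y] by (simp only: uminus_eq)

lemma finite_quadratic_trace:
  assumes \<alpha>: "\<And>i. i \<le> d \<Longrightarrow> \<alpha> i \<in> GF2 k" and k: "k \<ge> 1"
  shows "finite_quadratic (GF2 k) (\<lambda>x. trace_F2 k (poly (quad_poly d \<alpha>) x))"
proof
  fix x y z assume xyz: "x \<in> GF2 k" "y \<in> GF2 k" "z \<in> GF2 k"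
  have mem: "poly (radical_poly d \<alpha>) u \<in> GF2 k" if "u \<in> GF2 k" for u
    unfolding poly_radical_poly by (rule GF2_sum) (use that \<alpha> in auto)
  show "polar (\<lambda>x. trace_F2 k (poly (quad_poly d \<alpha>) x)) (x + y) z =
      polar (\<lambda>x. trace_F2 k (poly (quad_poly d \<alpha>) x)) x z + polar (\<lambda>x. trace_F2 k (poly (quad_poly d \<alpha>) x)) y z"
    using xyz by (simp only: polar_trace[of d \<alpha> k, OF \<alpha>] GF2_add radical_poly_add distrib_left
        trace_add GF2_mult GF2_power mem)
qed (use k in \<open>simp_all add: finite_GF2 diff_eq_add\<close>)

text \<open>
  The field \<open>GF2 (m * n)\<close> contains the whole kernel of the additive polynomial, so the radical has
  its maximal cardinality \<open>2 ^ (2 * d)\<close>.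
\<close>

locale split_form =
  fixes m d :: nat and \<alpha> :: "nat \<Rightarrow> F2bar" and n :: nat
  assumes m: "m \<ge> 1" and d: "d \<ge> 1" and \<alpha>: "\<And>i. i \<le> d \<Longrightarrow> \<alpha> i \<in> GF2 m" and lead: "\<alpha> d \<noteq> 0"
    and n: "n \<ge> 1" and roots: "\<And>x. poly (radical_poly d \<alpha>) x = 0 \<Longrightarrow> x \<in> GF2 (m * n)"
begin

lemma
  shows exp_sum_square_le: "(exp_sum m (quad_poly d \<alpha>) n)\<^sup>2 \<le> 2 ^ (m * n + 2 * d)"
    and exp_sum_square_eq: "\<forall>x\<in>radical (GF2 (m * n)) (\<lambda>x. trace_F2 (m * n) (poly (quad_poly d \<alpha>) x)).
        trace_F2 (m * n) (poly (quad_poly d \<alpha>) x) = 0 \<Longrightarrow>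
      (exp_sum m (quad_poly d \<alpha>) n)\<^sup>2 = 2 ^ (m * n + 2 * d)"
proof -
  have k: "m * n \<ge> 1"
    using m n by (simp add: Suc_le_eq)
  have \<alpha>': "\<alpha> i \<in> GF2 (m * n)" if "i \<le> d" for i
    using \<alpha>[OF that] GF2_mono[of m "m * n"] by auto
  interpret finite_quadratic "GF2 (m * n)" "\<lambda>x. trace_F2 (m * n) (poly (quad_poly d \<alpha>) x)"
    by (rule finite_quadratic_trace[OF \<alpha>' k])
  have "radical (GF2 (m * n)) (\<lambda>x. trace_F2 (m * n) (poly (quad_poly d \<alpha>) x)) =
      {x. poly (radical_poly d \<alpha>) x = 0}"
    using radical_trace[OF \<alpha>' k] roots by auto
  then have card: "int (card (GF2 (m * n)) * card (radical (GF2 (m * n))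
        (\<lambda>x. trace_F2 (m * n) (poly (quad_poly d \<alpha>) x)))) = 2 ^ (m * n + 2 * d)"
    using card_roots_radical_poly[of d \<alpha>] d lead by (simp add: card_GF2[OF k] power_add)
  show "(exp_sum m (quad_poly d \<alpha>) n)\<^sup>2 \<le> 2 ^ (m * n + 2 * d)"
    using square_le unfolding exp_sum_bit_sign card .
  show "(exp_sum m (quad_poly d \<alpha>) n)\<^sup>2 = 2 ^ (m * n + 2 * d)"
    if "\<forall>x\<in>radical (GF2 (m * n)) (\<lambda>x. trace_F2 (m * n) (poly (quad_poly d \<alpha>) x)).
        trace_F2 (m * n) (poly (quad_poly d \<alpha>) x) = 0"
    using square_eq[OF that] unfolding exp_sum_bit_sign card .
qed

text \<open>
  The complex number \<open>exp_sum_star\<close> is real; its sign and size are estimated on this real version.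
\<close>

definition normalized :: real where
  "normalized = of_int (exp_sum m (quad_poly d \<alpha>) n) / sqrt 2 ^ (m * n)"

lemma exp_sum_star_normalized: "exp_sum_star m (quad_poly d \<alpha>) n = of_real normalized"
  by (simp add: exp_sum_star_def normalized_def)

lemma normalized_square: "normalized\<^sup>2 = of_int ((exp_sum m (quad_poly d \<alpha>) n)\<^sup>2) / 2 ^ (m * n)"
proof -
  have "(sqrt 2 ^ (m * n))\<^sup>2 = (2::real) ^ (m * n)"
    by (simp add: power_mult[symmetric] mult.commute[of _ 2]) (simp add: power_mult)
  then show ?thesis
    by (simp add: normalized_def power_divide)
qed

lemma normalized_le: "\<bar>normalized\<bar> \<le> 2 ^ d"
proof -
  have "of_int ((exp_sum m (quad_poly d \<alpha>) n)\<^sup>2) \<le> (of_int (2 ^ (m * n + 2 * d)) :: real)"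
    by (subst of_int_le_iff) (rule exp_sum_square_le)
  then have "normalized\<^sup>2 \<le> (2 ^ d)\<^sup>2"
    unfolding normalized_square by (simp add: power_add field_simps flip: power_mult)
  then show ?thesis
    using abs_le_square_iff[of normalized "2 ^ d"] by simp
qed

lemma exp_sum_star_eq_power:
  assumes s: "s = 1 \<or> s = -1" and eps: "eps_n m (quad_poly d \<alpha>) n = s"
  shows "exp_sum_star m (quad_poly d \<alpha>) n = of_int s * 2 ^ d"
proof -
  let ?q = "\<lambda>x. trace_F2 (m * n) (poly (quad_poly d \<alpha>) x)"
  have sgn: "(\<forall>x\<in>radical (GF2 (m * n)) ?q. ?q x = 0) \<and> s * exp_sum m (quad_poly d \<alpha>) n > 0"
  proof (cases "s = 1")
    case True
    with quad_eps_eq_1_imp[OF eps[unfolded eps_n_def True]] show ?thesis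
      unfolding exp_sum_bit_sign by simp
  next
    case False
    with s have "s = -1"
      by simp
    with quad_eps_eq_minus_1_imp[OF eps[unfolded eps_n_def \<open>s = -1\<close>]] show ?thesis
      unfolding exp_sum_bit_sign by simp
  qed
  then have "(exp_sum m (quad_poly d \<alpha>) n)\<^sup>2 = 2 ^ (m * n + 2 * d)"
    using exp_sum_square_eq by blast
  then have "normalized\<^sup>2 = (2 ^ d)\<^sup>2"
    unfolding normalized_square by (simp add: power_add mult.commute flip: power_mult)
  then have "normalized = 2 ^ d \<or> normalized = - (2 ^ d)"
    by (simp add: power2_eq_iff)
  moreover have "of_int s * normalized > 0"
  proof -
    have "of_int (s * exp_sum m (quad_poly d \<alpha>) n) / sqrt 2 ^ (m * n) > 0"
      using sgn by (intro divide_pos_pos) (simp_all del: of_int_mult)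
    then show ?thesis
      by (simp add: normalized_def)
  qed
  moreover have "(2::real) ^ d > 0"
    by simp
  ultimately have "normalized = of_int s * 2 ^ d"
    using s by auto
  then show ?thesis
    using s by (auto simp: exp_sum_star_normalized)
qed

end


section \<open>The linear systems\<close>

text \<open>
  Let \<open>D\<close> be the number of reciprocal roots, counted with multiplicity. At a common multiple \<open>M'\<close> of \<open>M\<close>
  and of all their orders the normalised sum is \<open>- D\<close>, whence \<open>D \<le> 2 ^ d\<close>. At \<open>M\<close> it has absolute
  value \<open>2 ^ d\<close>, whence \<open>D \<ge> 2 ^ d\<close>. So \<open>D = 2 ^ d\<close>, which is the degree of the
  L-function, and the power sum at \<open>M\<close> is extremal.
\<close>

lemma zeta_power_eq_minus_eps:
  assumes split: "split_form m d \<alpha> M"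
    and \<mu>: "cyclotomic_multiplicities (L_star m (quad_poly d \<alpha>)) \<mu>"
    and s: "s = 1 \<or> s = -1" and eps: "eps_n m (quad_poly d \<alpha>) M = s"
    and l: "l \<in> cyclotomic_support \<mu>"
  shows "zeta l ^ M = - of_int s"
proof -
  let ?S = "cyclotomic_support \<mu>"
  define D where "D = (\<Sum>l\<in>?S. \<mu> l * totient l)"
  define M' where "M' = M * \<Prod>?S"
  interpret split_form m d \<alpha> M by fact
  have fin: "finite ?S"
    using \<mu> by (simp add: cyclotomic_multiplicities_def cyclotomic_support_def)
  have pos: "l \<ge> 1" if "l \<in> ?S" for l
    using that by (simp add: cyclotomic_support_def)
  have "\<Prod>?S \<noteq> 0"
    using fin pos by force
  then have M': "M' \<ge> 1"
    using n by (simp add: M'_def Suc_le_eq)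
  interpret M': split_form m d \<alpha> M'
  proof
    show "x \<in> GF2 (m * M')" if "poly (radical_poly d \<alpha>) x = 0" for x
      using roots[OF that] GF2_mono[of "m * M" "m * M'"] by (auto simp: M'_def)
  qed (use m d \<alpha> lead M' in auto)
  have star: "exp_sum_star m (quad_poly d \<alpha>) n = - (\<Sum>l\<in>?S. of_nat (\<mu> l) * ramanujan_sum l n)"
    if "n \<ge> 1" for n
    using exp_sum_star_eq_ramanujan[OF \<mu> that] .
  have "ramanujan_sum l M' = of_nat (totient l)" if "l \<in> ?S" for l
    by (rule ramanujan_sum_dvd) (use pos that fin in \<open>auto simp: M'_def intro!: dvd_mult dvd_prodI\<close>)
  then have "complex_of_real M'.normalized = - of_nat D"
    using star[OF M'] by (simp add: M'.exp_sum_star_normalized D_def)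
  then have "M'.normalized = - real D"
    by (metis of_real_eq_iff of_real_minus of_real_of_nat_eq)
  then have D_le: "real D \<le> 2 ^ d"
    using M'.normalized_le by simp
  have star_M: "(\<Sum>l\<in>?S. of_nat (\<mu> l) * ramanujan_sum l M) = - of_int s * 2 ^ d"
    using star[OF n] exp_sum_star_eq_power[OF s eps] by (simp add: minus_equation_iff)
  have norm_ram: "norm (ramanujan_sum l M) \<le> totient l" for l
    unfolding ramanujan_sum_def totient_def
    by (rule order.trans[OF norm_sum]) (simp add: norm_power)
  have "(2::real) ^ d = norm (\<Sum>l\<in>?S. of_nat (\<mu> l) * ramanujan_sum l M)"
    unfolding star_M using s by (auto simp: norm_mult norm_power)
  also have "\<dots> \<le> (\<Sum>l\<in>?S. norm (of_nat (\<mu> l) * ramanujan_sum l M))"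
    by (rule norm_sum)
  also have "\<dots> \<le> (\<Sum>l\<in>?S. real (\<mu> l) * real (totient l))"
    by (rule sum_mono) (use norm_ram in \<open>auto simp: norm_mult intro!: mult_left_mono\<close>)
  also have "\<dots> = real D"
    by (simp add: D_def)
  finally have "D = 2 ^ d"
    using D_le by (metis antisym of_nat_eq_iff of_nat_numeral of_nat_power)
  then have "(\<Sum>l\<in>?S. of_nat (\<mu> l) * ramanujan_sum l M) = - of_int s * of_nat (\<Sum>l\<in>?S. \<mu> l * totient l)"
    using star_M by (simp add: D_def)
  then show ?thesis
    by (intro zeta_power_eq_if_sum_extremal[of _ ?S \<mu>])
       (use s fin l in \<open>auto simp: cyclotomic_support_def\<close>)
qed

text \<open>
  All orders divide \<open>M\<close>, so the sum over the support of \<open>\<mu>\<close> is a sum over the divisors of \<open>M\<close>.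
\<close>

lemma ramanujan_system_elliptic:
  assumes split: "split_form m d \<alpha> M"
    and \<mu>: "cyclotomic_multiplicities (L_star m (quad_poly d \<alpha>)) \<mu>"
    and eps: "eps_n m (quad_poly d \<alpha>) M = -1"
  shows "divisor_mat_vec M (ramanujan_matrix M) (divisor_vec M (\<lambda>l. of_nat (\<mu> l))) =
      divisor_vec M (\<lambda>e. - exp_sum_star m (quad_poly d \<alpha>) e)"
proof -
  interpret split_form m d \<alpha> M by fact
  have sub: "cyclotomic_support \<mu> \<subseteq> {l. l dvd M}"
  proof safe
    fix l assume l: "l \<in> cyclotomic_support \<mu>"
    then have "zeta l ^ M = 1"
      using zeta_power_eq_minus_eps[OF split \<mu> _ eps l] by simp
    then show "l dvd M"
      using l by (simp add: zeta_power_eq_1_iff cyclotomic_support_def)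
  qed
  have "(\<Sum>l | l dvd M. ramanujan_sum l e * of_nat (\<mu> l)) = - exp_sum_star m (quad_poly d \<alpha>) e"
    if e: "e dvd M" for e
  proof -
    have "e \<ge> 1"
      using e n by (auto simp: Suc_le_eq intro!: Nat.gr0I)
    have "(\<Sum>l | l dvd M. ramanujan_sum l e * of_nat (\<mu> l)) =
        (\<Sum>l\<in>cyclotomic_support \<mu>. of_nat (\<mu> l) * ramanujan_sum l e)"
      by (rule sum.mono_neutral_cong_right)
         (use n sub in \<open>auto simp: cyclotomic_support_def mult.commute intro!: Nat.gr0I\<close>)
    then show ?thesis
      using exp_sum_star_eq_ramanujan[OF \<mu> \<open>e \<ge> 1\<close>] by simp
  qed
  then show ?thesis
    by (auto simp: divisor_mat_vec_def ramanujan_matrix_def divisor_vec_def restrict_def fun_eq_iff intro!: sum.cong)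
qed

text \<open>
  Here the \<open>M\<close>-th power of every reciprocal root is \<open>-1\<close>, so all orders are of the form
  \<open>2 ^ (b + 1) * l\<close> with \<open>l\<close> dividing \<open>N'\<close>. Evaluating at \<open>2 ^ b * e\<close> makes \<open>- 2 ^ b\<close> a common
  factor of all Ramanujan sums, whose sign cancels the one in front of the sum.
\<close>

lemma ramanujan_system_hyperbolic:
  assumes split: "split_form m d \<alpha> (2 ^ b * N')" and odd: "odd N'"
    and \<mu>: "cyclotomic_multiplicities (L_star m (quad_poly d \<alpha>)) \<mu>"
    and eps: "eps_n m (quad_poly d \<alpha>) (2 ^ b * N') = 1"
  shows "divisor_mat_vec N' (divisor_mat_scale N' (2 ^ b) (ramanujan_matrix N'))
        (divisor_vec N' (\<lambda>l. of_nat (\<mu> (2 ^ (b + 1) * l)))) =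
      divisor_vec N' (\<lambda>e. exp_sum_star m (quad_poly d \<alpha>) (2 ^ b * e))"
proof -
  have N': "N' \<ge> 1"
    using odd by (cases N') auto
  have sub: "cyclotomic_support \<mu> \<subseteq> (\<lambda>l. 2 ^ (b + 1) * l) ` {l. l dvd N'}"
  proof
    fix l assume l: "l \<in> cyclotomic_support \<mu>"
    then have "zeta l ^ (2 ^ b * N') = -1"
      using zeta_power_eq_minus_eps[OF split \<mu> _ eps l] by simp
    moreover have "l \<ge> 1"
      using l by (simp add: cyclotomic_support_def)
    ultimately obtain l' where "l' dvd N'" "l = 2 ^ (b + 1) * l'"
      using odd eq_two_power_times_divisor by blast
    then show "l \<in> (\<lambda>l. 2 ^ (b + 1) * l) ` {l. l dvd N'}"
      by blast
  qed
  have "(\<Sum>l | l dvd N'. 2 ^ b * ramanujan_sum l e * of_nat (\<mu> (2 ^ (b + 1) * l))) =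
      exp_sum_star m (quad_poly d \<alpha>) (2 ^ b * e)" if e: "e dvd N'" for e
  proof -
    have "2 ^ b * e \<ge> 1"
      using e N' by (auto simp: Suc_le_eq intro!: Nat.gr0I)
    then have "exp_sum_star m (quad_poly d \<alpha>) (2 ^ b * e) =
        - (\<Sum>l\<in>cyclotomic_support \<mu>. of_nat (\<mu> l) * ramanujan_sum l (2 ^ b * e))"
      by (rule exp_sum_star_eq_ramanujan[OF \<mu>])
    also have "(\<Sum>l\<in>cyclotomic_support \<mu>. of_nat (\<mu> l) * ramanujan_sum l (2 ^ b * e)) =
        (\<Sum>l\<in>(\<lambda>l. 2 ^ (b + 1) * l) ` {l. l dvd N'}. of_nat (\<mu> l) * ramanujan_sum l (2 ^ b * e))"
      by (rule sum.mono_neutral_left)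
         (use N' sub in \<open>auto simp: cyclotomic_support_def intro!: Nat.gr0I\<close>)
    also have "\<dots> = (\<Sum>l | l dvd N'. of_nat (\<mu> (2 ^ (b + 1) * l)) * ramanujan_sum (2 ^ (b + 1) * l) (2 ^ b * e))"
      by (subst sum.reindex) (auto simp: inj_on_def)
    also have "\<dots> = (\<Sum>l | l dvd N'. - (2 ^ b * ramanujan_sum l e * of_nat (\<mu> (2 ^ (b + 1) * l))))"
    proof (rule sum.cong[OF refl])
      fix l assume "l \<in> {l. l dvd N'}"
      then have "odd l" "odd e"
        using odd e by (auto elim: dvd_trans)
      then show "of_nat (\<mu> (2 ^ (b + 1) * l)) * ramanujan_sum (2 ^ (b + 1) * l) (2 ^ b * e) =
          - (2 ^ b * ramanujan_sum l e * of_nat (\<mu> (2 ^ (b + 1) * l)))"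
        by (subst ramanujan_sum_two_power) auto
    qed
    finally show ?thesis
      by (simp add: sum_negf)
  qed
  then show ?thesis
    by (auto simp: divisor_mat_vec_def divisor_mat_scale_def ramanujan_matrix_def divisor_vec_def restrict_def fun_eq_iff intro!: sum.cong)
qed

theorem proposition4p3:
  fixes m d0 N a N' :: nat
    and \<alpha> :: "nat \<Rightarrow> F2bar"
    and R f Rt :: "F2bar poly"
    and \<mu> :: "nat \<Rightarrow> nat"
  assumes "m \<ge> 2" and "even m" and "d0 \<ge> 1"
    and "\<forall>i\<le>d0. \<alpha> i \<in> GF2 m" and "\<alpha> d0 \<noteq> 0"
    and "R = (\<Sum>i\<le>d0. monom (\<alpha> i) (2 ^ i))"
    and "f = monom 1 1 * R"
    and "Rt = (\<Sum>i\<le>d0. monom (\<alpha> i ^ (2 ^ d0)) (2 ^ (d0 + i))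
                       + monom (\<alpha> i ^ (2 ^ (d0 - i))) (2 ^ (d0 - i)))"
    and "N \<ge> 1" and "splitting_field (GF2 m) Rt = GF2 (m * N)"
    and "N = 2 ^ a * N'" and "odd N'"
    and "cyclotomic_multiplicities (L_star m f) \<mu>"
  shows
    "(eps_n m f N = -1 \<longrightarrow>
        divisor_mat_vec N (ramanujan_matrix N) (divisor_vec N (\<lambda>l. of_nat (\<mu> l)))
          = divisor_vec N (\<lambda>d. - exp_sum_star m f d))
   \<and> (eps_n m f N = 1 \<longrightarrow>
        divisor_mat_vec N' (divisor_mat_scale N' (2 ^ a) (ramanujan_matrix N'))
            (divisor_vec N' (\<lambda>l. of_nat (\<mu> (2 ^ (a + 1) * l))))
          = divisor_vec N' (\<lambda>d. exp_sum_star m f (2 ^ a * d)))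
   \<and> (eps_n m f N = 0 \<and> eps_n m f (2 * N) = -1 \<longrightarrow>
        divisor_mat_vec (2 * N) (ramanujan_matrix (2 * N))
            (divisor_vec (2 * N) (\<lambda>l. of_nat (\<mu> l)))
          = divisor_vec (2 * N) (\<lambda>d. - exp_sum_star m f d))
   \<and> (eps_n m f N = 0 \<and> eps_n m f (2 * N) = 1 \<longrightarrow>
        divisor_mat_vec N' (divisor_mat_scale N' (2 ^ (a + 1)) (ramanujan_matrix N'))
            (divisor_vec N' (\<lambda>l. of_nat (\<mu> (2 ^ (a + 2) * l))))
          = divisor_vec N' (\<lambda>d. exp_sum_star m f (2 ^ (a + 1) * d)))"
proof -
  have f: "f = quad_poly d0 \<alpha>" and Rt: "Rt = radical_poly d0 \<alpha>"
    using assms by (simp_all add: quad_poly_def radical_poly_def)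
  have split: "split_form m d0 \<alpha> M" if "N dvd M" "M \<ge> 1" for M
  proof
    fix x assume "poly (radical_poly d0 \<alpha>) x = 0"
    then have "x \<in> splitting_field (GF2 m) Rt"
      unfolding splitting_field_def Rt by (intro generate_field.incl) simp
    also have "\<dots> = GF2 (m * N)"
      by fact
    also have "\<dots> \<subseteq> GF2 (m * M)"
      using that by (intro GF2_mono) simp
    finally show "x \<in> GF2 (m * M)" .
  qed (use assms that in auto)
  have N: "N = 2 ^ a * N'" "2 * N = 2 ^ (a + 1) * N'"
    using assms by simp_all
  have split_N: "split_form m d0 \<alpha> N" and split_2N: "split_form m d0 \<alpha> (2 * N)"
    using split \<open>N \<ge> 1\<close> by simp_all
  \<comment> \<open>The case \<open>\<epsilon>\<^sub>N = 0\<close> differs from the other two only in that \<open>2 N\<close> takes the place of \<open>N\<close>.\<close>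
  note \<mu> = \<open>cyclotomic_multiplicities (L_star m f) \<mu>\<close>[unfolded f]
  show ?thesis
    unfolding f
  proof (intro conjI impI)
    assume "eps_n m (quad_poly d0 \<alpha>) N = -1"
    then show "divisor_mat_vec N (ramanujan_matrix N) (divisor_vec N (\<lambda>l. of_nat (\<mu> l)))
          = divisor_vec N (\<lambda>d. - exp_sum_star m (quad_poly d0 \<alpha>) d)"
      by (rule ramanujan_system_elliptic[OF split_N \<mu>])
  next
    assume "eps_n m (quad_poly d0 \<alpha>) N = 1"
    then show "divisor_mat_vec N' (divisor_mat_scale N' (2 ^ a) (ramanujan_matrix N'))
            (divisor_vec N' (\<lambda>l. of_nat (\<mu> (2 ^ (a + 1) * l))))
          = divisor_vec N' (\<lambda>d. exp_sum_star m (quad_poly d0 \<alpha>) (2 ^ a * d))"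
      using ramanujan_system_hyperbolic[OF split_N[unfolded N(1)] \<open>odd N'\<close> \<mu>] by (simp only: N(1))
  next
    assume "eps_n m (quad_poly d0 \<alpha>) N = 0 \<and> eps_n m (quad_poly d0 \<alpha>) (2 * N) = -1"
    then show "divisor_mat_vec (2 * N) (ramanujan_matrix (2 * N))
            (divisor_vec (2 * N) (\<lambda>l. of_nat (\<mu> l)))
          = divisor_vec (2 * N) (\<lambda>d. - exp_sum_star m (quad_poly d0 \<alpha>) d)"
      by (intro ramanujan_system_elliptic[OF split_2N \<mu>]) simp
  next
    assume "eps_n m (quad_poly d0 \<alpha>) N = 0 \<and> eps_n m (quad_poly d0 \<alpha>) (2 * N) = 1"
    then have "eps_n m (quad_poly d0 \<alpha>) (2 ^ (a + 1) * N') = 1"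
      by (simp only: N(2))
    then have "divisor_mat_vec N' (divisor_mat_scale N' (2 ^ (a + 1)) (ramanujan_matrix N'))
            (divisor_vec N' (\<lambda>l. of_nat (\<mu> (2 ^ (a + 1 + 1) * l))))
          = divisor_vec N' (\<lambda>d. exp_sum_star m (quad_poly d0 \<alpha>) (2 ^ (a + 1) * d))"
      by (rule ramanujan_system_hyperbolic[OF split_2N[unfolded N(2)] \<open>odd N'\<close> \<mu>])
    then show "divisor_mat_vec N' (divisor_mat_scale N' (2 ^ (a + 1)) (ramanujan_matrix N'))
            (divisor_vec N' (\<lambda>l. of_nat (\<mu> (2 ^ (a + 2) * l))))
          = divisor_vec N' (\<lambda>d. exp_sum_star m (quad_poly d0 \<alpha>) (2 ^ (a + 1) * d))"
      by (simp only: add.assoc one_add_one)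
  qed
qed
end
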